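(* Let $\hat{\mathbb{E}}$ be the $G$-expectation on $\Omega=C_0(\mathbb{R};\mathbb{R}^d)$ and $U_tX=X\circ\theta_t$ with $\theta_t\omega(\cdot)=\omega(\cdot+t)-\omega(t)$. For all $\tau\ne0$, the $G$-expectation system $(\Omega,L^2_G(\Omega),U_\tau,\hat{\mathbb{E}})$ is ergodic, and hence $(\Omega,L^2_G(\Omega),(U_t)_{t\ge0},\hat{\mathbb{E}})$ and $(\Omega,L^2_G(\Omega),(U_t)_{t\in\mathbb{R}},\hat{\mathbb{E}})$ are ergodic.
   Context: A sublinear expectation on a vector lattice $\mathcal{H}$ of functions (linear space containing constants, closed under $|\cdot|$ and under composition with the test functions below) is a monotone, constant-preserving, sub-additive, positively homogeneous functional. $Y$ is independent from $X$ if $\hat{\mathbb{E}}[\phi(X,Y)]=\hat{\mathbb{E}}[\hat{\mathbb{E}}[\phi(x,Y)]|_{x=X}]$ for test functions $\phi$. A $d$-dimensional random vector $\xi$ is $G$-normally distributed if $a\xi+b\bar\xi\overset{d}{=}\sqrt{a^2+b^2}\,\xi$ for all $a,b\ge0$, where $\bar\xi$ is an independent copy of $\xi$ (and $\overset{d}{=}$ means equal expectations of all test functions); here $G(A)=\frac12\hat{\mathbb{E}}[\langle A\xi,\xi\rangle]$. $\Omega=C_0(\mathbb{R};\mathbb{R}^d)$ is the space of continuous paths with $\omega_0=0$, $B_t(\omega)=\omega_t$. $C_{l,lip}(\mathbb{R}^{k})$: functions with $|\phi(x)-\phi(y)|\le L(1+|x|^q+|y|^q)|x-y|$ for some $L>0,q\ge1$.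 $Lip(\Omega)=\{\phi(B_{t_1}-B_{t_0},\dots,B_{t_n}-B_{t_{n-1}}):n\ge1,\ t_0<\dots<t_n,\ \phi\in C_{l,lip}(\mathbb{R}^{d\times n})\}$. Given $G$-normal vectors $\xi_1,\xi_2,\dots$ on some space $(\tilde\Omega,\tilde{\mathcal{H}},\tilde{\mathbb{E}})$, identically distributed, with $\xi_{i+1}$ independent from $(\xi_1,\dots,\xi_i)$, the $G$-expectation is $$\hat{\mathbb{E}}[\phi(B_{t_1}-B_{t_0},\dots,B_{t_n}-B_{t_{n-1}})]:=\tilde{\mathbb{E}}[\phi(\sqrt{t_1-t_0}\,\xi_1,\dots,\sqrt{t_n-t_{n-1}}\,\xi_n)].$$ $L^p_G(\Omega)$ is the completion of $Lip(\Omega)$ under $(\hat{\mathbb{E}}[|X|^p])^{1/p}$; $\hat{\mathbb{E}}$ and $U_t$ extend to it and $U_t$ preserves $\hat{\mathbb{E}}$. $X\ge Y$ $\hat{\mathbb{E}}$-q.s. means $\hat{\mathbb{E}}[(X-Y)^-]=0$; $X=Y$ q.s. means both inequalities hold. A system $(\Omega,\mathcal{H},(U_t)_{t\in\mathbb{T}},\hat{\mathbb{E}})$ is ergodic if every $X\in\mathcal{H}$ with $U_tX=X$ $\hat{\mathbb{E}}$-q.s. for all $t\in\mathbb{T}$ is constant $\hat{\mathbb{E}}$-q.s.; $(\Omega,\mathcal{H},U_\tau,\hat{\mathbb{E}})$ denotes the discrete-time system generated by the iterates of the single operator $U_\tau$. *)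

theory Defs
  imports "HOL-Analysis.Analysis"
begin

section \<open>Test functions\<close>

text \<open>A point of the n-fold product of a space is an infinite sequence of which only the first n
  entries matter. The growth condition in \<open>C_l_lip n\<close> forces a test function to depend on these
  entries only. With entries in \<open>real\<close> this is the class on R^n, with entries in
  \<open>real ^ 'd\<close> the class on R^(d x n), both for the Euclidean norm.\<close>

definition tuple_norm :: "nat \<Rightarrow> (nat \<Rightarrow> 'a::real_normed_vector) \<Rightarrow> real" where
  "tuple_norm n x = L2_set (\<lambda>i. norm (x i)) {..<n}"

definition C_l_lip :: "nat \<Rightarrow> ((nat \<Rightarrow> 'a::real_normed_vector) \<Rightarrow> real) set" where
  "C_l_lip n = {\<phi>. \<exists>L q. L > 0 \<and> q \<ge> 1 \<and>
     (\<forall>x y. \<bar>\<phi> x - \<phi> y\<bar>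
        \<le> L * (1 + tuple_norm n x powr q + tuple_norm n y powr q) * tuple_norm n (\<lambda>i. x i - y i))}"

definition tuple_append :: "nat \<Rightarrow> (nat \<Rightarrow> 'a) \<Rightarrow> (nat \<Rightarrow> 'a) \<Rightarrow> nat \<Rightarrow> 'a" where
  "tuple_append m x y = (\<lambda>i. if i < m then x i else y (i - m))"


section \<open>Sublinear expectation spaces\<close>

locale sublinear_expectation =
  fixes H :: "('w \<Rightarrow> real) set" and E :: "('w \<Rightarrow> real) \<Rightarrow> real"
  assumes const_mem: "(\<lambda>_. c) \<in> H"
    and add_mem: "X \<in> H \<Longrightarrow> Y \<in> H \<Longrightarrow> (\<lambda>w. X w + Y w) \<in> H"
    and scale_mem: "X \<in> H \<Longrightarrow> (\<lambda>w. c * X w) \<in> H"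
    and abs_mem: "X \<in> H \<Longrightarrow> (\<lambda>w. \<bar>X w\<bar>) \<in> H"
    and comp_mem: "\<phi> \<in> C_l_lip k \<Longrightarrow> (\<And>i. i < k \<Longrightarrow> Z i \<in> H) \<Longrightarrow> (\<lambda>w. \<phi> (\<lambda>i. Z i w)) \<in> H"
    and mono: "X \<in> H \<Longrightarrow> Y \<in> H \<Longrightarrow> (\<And>w. X w \<le> Y w) \<Longrightarrow> E X \<le> E Y"
    and const: "E (\<lambda>_. c) = c"
    and subadd: "X \<in> H \<Longrightarrow> Y \<in> H \<Longrightarrow> E (\<lambda>w. X w + Y w) \<le> E X + E Y"
    and pos_hom: "X \<in> H \<Longrightarrow> c \<ge> 0 \<Longrightarrow> E (\<lambda>w. c * X w) = c * E X"

definition random_vector :: "('w \<Rightarrow> real) set \<Rightarrow> ('w \<Rightarrow> real ^ 'd) \<Rightarrow> bool" where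
  "random_vector H X \<longleftrightarrow> (\<forall>j. (\<lambda>w. X w $ j) \<in> H)"

definition eq_dist ::
  "(('w \<Rightarrow> real) \<Rightarrow> real) \<Rightarrow> ('w \<Rightarrow> 'a::real_normed_vector) \<Rightarrow> ('w \<Rightarrow> 'a) \<Rightarrow> bool" where
  "eq_dist E X Y \<longleftrightarrow> (\<forall>\<phi> \<in> C_l_lip 1. E (\<lambda>w. \<phi> (\<lambda>_. X w)) = E (\<lambda>w. \<phi> (\<lambda>_. Y w)))"

text \<open>\<open>indep_from E n Y m X\<close>: the n-tuple Y is independent from the m-tuple X
  (the relation is not symmetric).\<close>

definition indep_from ::
  "(('w \<Rightarrow> real) \<Rightarrow> real) \<Rightarrow> nat \<Rightarrow> ('w \<Rightarrow> nat \<Rightarrow> 'a::real_normed_vector)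
     \<Rightarrow> nat \<Rightarrow> ('w \<Rightarrow> nat \<Rightarrow> 'a) \<Rightarrow> bool" where
  "indep_from E n Y m X \<longleftrightarrow>
     (\<forall>\<phi> \<in> C_l_lip (m + n).
        E (\<lambda>w. \<phi> (tuple_append m (X w) (Y w)))
      = E (\<lambda>w. E (\<lambda>v. \<phi> (tuple_append m (X w) (Y v)))))"

definition indep_copy ::
  "('w \<Rightarrow> real) set \<Rightarrow> (('w \<Rightarrow> real) \<Rightarrow> real) \<Rightarrow> ('w \<Rightarrow> real ^ 'd) \<Rightarrow> ('w \<Rightarrow> real ^ 'd) \<Rightarrow> bool" where
  "indep_copy H E Y X \<longleftrightarrow>
     random_vector H Y \<and> eq_dist E Y X \<and> indep_from E 1 (\<lambda>w _. Y w) 1 (\<lambda>w _. X w)"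

text \<open>The law of the pair of X and an independent copy of X is determined by the law of X, so the
  choice of the copy is immaterial.\<close>

definition G_normal ::
  "('w \<Rightarrow> real) set \<Rightarrow> (('w \<Rightarrow> real) \<Rightarrow> real) \<Rightarrow> (real ^ 'd ^ 'd \<Rightarrow> real) \<Rightarrow> ('w \<Rightarrow> real ^ 'd) \<Rightarrow> bool" where
  "G_normal H E G X \<longleftrightarrow>
     random_vector H X \<and>
     (\<exists>Y. indep_copy H E Y X \<and>
        (\<forall>a\<ge>0. \<forall>b\<ge>0. eq_dist E (\<lambda>w. a *\<^sub>R X w + b *\<^sub>R Y w) (\<lambda>w. sqrt (a\<^sup>2 + b\<^sup>2) *\<^sub>R X w))) \<and>
     (\<forall>A. transpose A = A \<longrightarrow> G A = 1 / 2 * E (\<lambda>w. (A *v X w) \<bullet> X w))"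


section \<open>Path space and the G-expectation on cylinder functions\<close>

typedef ('d::finite) paths = "{\<omega> :: real \<Rightarrow> real ^ 'd. continuous_on UNIV \<omega> \<and> \<omega> 0 = 0}"
  morphisms B_path Abs_paths
  by (intro exI[of _ "\<lambda>_. 0"]) simp

setup_lifting type_definition_paths

definition B :: "real \<Rightarrow> 'd::finite paths \<Rightarrow> real ^ 'd" where
  "B t \<omega> = B_path \<omega> t"

lift_definition shift :: "real \<Rightarrow> 'd::finite paths \<Rightarrow> 'd paths"
  is "\<lambda>t \<omega> s. \<omega> (s + t) - \<omega> t"
  by (auto intro!: continuous_intros elim!: continuous_on_compose2)

text \<open>\<open>cylinder_rep n t \<phi> X\<close>: X is the test function \<open>\<phi>\<close> of the increments of B over the
  partition \<open>t 0 < \<dots> < t n\<close>.\<close>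

definition cylinder_rep ::
  "nat \<Rightarrow> (nat \<Rightarrow> real) \<Rightarrow> ((nat \<Rightarrow> real ^ 'd) \<Rightarrow> real) \<Rightarrow> ('d::finite paths \<Rightarrow> real) \<Rightarrow> bool" where
  "cylinder_rep n t \<phi> X \<longleftrightarrow>
     n \<ge> 1 \<and> (\<forall>i<n. t i < t (Suc i)) \<and> \<phi> \<in> C_l_lip n \<and>
     X = (\<lambda>\<omega>. \<phi> (\<lambda>i. B (t (Suc i)) \<omega> - B (t i) \<omega>))"

definition Lip_Omega :: "('d::finite paths \<Rightarrow> real) set" where
  "Lip_Omega = {X. \<exists>n t \<phi>. cylinder_rep n t \<phi> X}"

text \<open>The sequence of G-normal vectors is numbered from 0. The value does not depend on the
  representation of X.\<close>

definition G_expectation ::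
  "(('w \<Rightarrow> real) \<Rightarrow> real) \<Rightarrow> (nat \<Rightarrow> 'w \<Rightarrow> real ^ 'd) \<Rightarrow> ('d::finite paths \<Rightarrow> real) \<Rightarrow> real" where
  "G_expectation E \<xi> X =
     (THE v. \<exists>n t \<phi>. cylinder_rep n t \<phi> X \<and>
        v = E (\<lambda>w. \<phi> (\<lambda>i. sqrt (t (Suc i) - t i) *\<^sub>R \<xi> i w)))"


section \<open>Completion\<close>

text \<open>The completion of H under the p-seminorm is the set of equivalence classes of Cauchy
  sequences; continuous operations on H extend termwise.\<close>

definition Lp_norm :: "(('w \<Rightarrow> real) \<Rightarrow> real) \<Rightarrow> real \<Rightarrow> ('w \<Rightarrow> real) \<Rightarrow> real" where
  "Lp_norm E p X = E (\<lambda>w. \<bar>X w\<bar> powr p) powr (1 / p)"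

definition Lp_Cauchy ::
  "('w \<Rightarrow> real) set \<Rightarrow> (('w \<Rightarrow> real) \<Rightarrow> real) \<Rightarrow> real \<Rightarrow> (nat \<Rightarrow> 'w \<Rightarrow> real) set" where
  "Lp_Cauchy H E p = {X. (\<forall>n. X n \<in> H) \<and>
     (\<forall>e>0. \<exists>N. \<forall>m\<ge>N. \<forall>n\<ge>N. Lp_norm E p (\<lambda>w. X m w - X n w) < e)}"

definition Lp_rel ::
  "('w \<Rightarrow> real) set \<Rightarrow> (('w \<Rightarrow> real) \<Rightarrow> real) \<Rightarrow> real \<Rightarrow> (nat \<Rightarrow> 'w \<Rightarrow> real) rel" where
  "Lp_rel H E p = {(X, Y). X \<in> Lp_Cauchy H E p \<and> Y \<in> Lp_Cauchy H E p \<and>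
     (\<lambda>n. Lp_norm E p (\<lambda>w. X n w - Y n w)) \<longlonglongrightarrow> 0}"

definition Lp_lift ::
  "('w \<Rightarrow> real) set \<Rightarrow> (('w \<Rightarrow> real) \<Rightarrow> real) \<Rightarrow> real \<Rightarrow> (('w \<Rightarrow> real) \<Rightarrow> 'w \<Rightarrow> real)
     \<Rightarrow> (nat \<Rightarrow> 'w \<Rightarrow> real) set \<Rightarrow> (nat \<Rightarrow> 'w \<Rightarrow> real) set" where
  "Lp_lift H E p f C = (\<Union>X\<in>C. Lp_rel H E p `` {\<lambda>n. f (X n)})"

definition Lp_lift2 ::
  "('w \<Rightarrow> real) set \<Rightarrow> (('w \<Rightarrow> real) \<Rightarrow> real) \<Rightarrow> real
     \<Rightarrow> (('w \<Rightarrow> real) \<Rightarrow> ('w \<Rightarrow> real) \<Rightarrow> 'w \<Rightarrow> real)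
     \<Rightarrow> (nat \<Rightarrow> 'w \<Rightarrow> real) set \<Rightarrow> (nat \<Rightarrow> 'w \<Rightarrow> real) set \<Rightarrow> (nat \<Rightarrow> 'w \<Rightarrow> real) set" where
  "Lp_lift2 H E p f C D = (\<Union>X\<in>C. \<Union>Y\<in>D. Lp_rel H E p `` {\<lambda>n. f (X n) (Y n)})"


section \<open>Ergodic systems\<close>

text \<open>Elements of a completion are not functions, so the operations entering the definition of
  quasi-sure relations are carried along with the space.\<close>

record 'x expectation_space =
  elements :: "'x set"
  diff :: "'x \<Rightarrow> 'x \<Rightarrow> 'x"
  neg_part :: "'x \<Rightarrow> 'x"
  const_elem :: "real \<Rightarrow> 'x"
  expect :: "'x \<Rightarrow> real"

definition qs_ge :: "'x expectation_space \<Rightarrow> 'x \<Rightarrow> 'x \<Rightarrow> bool" where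
  "qs_ge S X Y \<longleftrightarrow> expect S (neg_part S (diff S X Y)) = 0"

definition qs_eq :: "'x expectation_space \<Rightarrow> 'x \<Rightarrow> 'x \<Rightarrow> bool" where
  "qs_eq S X Y \<longleftrightarrow> qs_ge S X Y \<and> qs_ge S Y X"

definition ergodic :: "'x expectation_space \<Rightarrow> 't set \<Rightarrow> ('t \<Rightarrow> 'x \<Rightarrow> 'x) \<Rightarrow> bool" where
  "ergodic S T U \<longleftrightarrow>
     (\<forall>X \<in> elements S. (\<forall>t\<in>T. qs_eq S (U t X) X) \<longrightarrow> (\<exists>c. qs_eq S X (const_elem S c)))"

definition Lp_space ::
  "('w \<Rightarrow> real) set \<Rightarrow> (('w \<Rightarrow> real) \<Rightarrow> real) \<Rightarrow> real \<Rightarrow> (nat \<Rightarrow> 'w \<Rightarrow> real) set expectation_space" where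
  "Lp_space H E p = \<lparr>
     elements = Lp_Cauchy H E p // Lp_rel H E p,
     diff = Lp_lift2 H E p (\<lambda>X Y w. X w - Y w),
     neg_part = Lp_lift H E p (\<lambda>X w. max (- X w) 0),
     const_elem = (\<lambda>c. Lp_rel H E p `` {\<lambda>_ _. c}),
     expect = (\<lambda>C. THE v. \<forall>X\<in>C. (\<lambda>n. E (X n)) \<longlonglongrightarrow> v) \<rparr>"

definition L_G ::
  "real \<Rightarrow> (('w \<Rightarrow> real) \<Rightarrow> real) \<Rightarrow> (nat \<Rightarrow> 'w \<Rightarrow> real ^ 'd)
     \<Rightarrow> (nat \<Rightarrow> 'd::finite paths \<Rightarrow> real) set expectation_space" where
  "L_G p E \<xi> = Lp_space Lip_Omega (G_expectation E \<xi>) p"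

definition U_G ::
  "real \<Rightarrow> (('w \<Rightarrow> real) \<Rightarrow> real) \<Rightarrow> (nat \<Rightarrow> 'w \<Rightarrow> real ^ 'd) \<Rightarrow> real
     \<Rightarrow> (nat \<Rightarrow> 'd::finite paths \<Rightarrow> real) set \<Rightarrow> (nat \<Rightarrow> 'd paths \<Rightarrow> real) set" where
  "U_G p E \<xi> t = Lp_lift Lip_Omega (G_expectation E \<xi>) p (\<lambda>X. X \<circ> shift t)"

end

theory Submission
  imports Defs
begin

text \<open>Let \<open>X\<close> be invariant and \<open>Y\<close> a cylinder function close to \<open>X\<close>. For large \<open>n\<close> the intervals
  of time entering \<open>Y\<close> and \<open>U\<^sub>n\<^sub>\<tau> Y\<close> are disjoint, so the later one of the two is
  independent from the earlier one, and \<open>E \<bar>Y - U\<^sub>n\<^sub>\<tau> Y\<bar>\<close> is the expectation of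
  \<open>f Y\<close> with \<open>f c = E \<bar>Y - c\<bar>\<close>, hence at least \<open>inf f\<close>. By invariance
  \<open>E \<bar>Y - U\<^sub>n\<^sub>\<tau> Y\<bar>\<close> is small, so some constant is close to \<open>Y\<close> and thus to \<open>X\<close>.
  That the G-expectation of a cylinder function does not depend on its representation rests on
  the stability of the G-normal law: inserting a point into the partition splits an increment
  into two, which the semigroup property merges again.\<close>

section \<open>Test functions\<close>

text \<open>Under a sublinear expectation independence is not symmetric and iterated expectations
  cannot be interchanged, so the earlier block of increments has to stay outside and the later one
  inside. The bound by \<open>inf f\<close> then rests on monotonicity and preservation of
  constants. The infimum itself never appears: every lower bound \<open>b\<close> of
  \<open>f\<close> is shown to bound the expectation of the shifted difference from below. A
  backward shift is turned into a forward one because shifting preserves the expectation, which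
  settles negative \<tau>. Quasi-sure equality of two classes means that the first absolute moment
  of the difference tends to 0. The L2 seminorm dominates this moment, so the ergodic argument runs
  in first moments on sequences of cylinder functions. The constant it yields depends on the
  accuracy; completeness of the reals then gives a single one. Each accuracy uses invariance at one
  large multiple of \<tau>, so continuous time reduces to integer times.\<close>

definition sum_norm :: "nat \<Rightarrow> (nat \<Rightarrow> 'a::real_normed_vector) \<Rightarrow> real" where
  "sum_norm n x = (\<Sum>i<n. norm (x i))"

text \<open>\<open>poly_lip n\<close> is the class \<open>C_l_lip n\<close>. The product of the two weights, in place of a sum of
  powers, makes the constants multiply when functions are composed or a coordinate is integrated
  out.\<close>

definition poly_lip :: "nat \<Rightarrow> ((nat \<Rightarrow> 'a::real_normed_vector) \<Rightarrow> real) \<Rightarrow> bool" where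
  "poly_lip n f \<longleftrightarrow> (\<exists>C k. C \<ge> 0 \<and> (\<forall>x y. \<bar>f x - f y\<bar>
     \<le> C * ((1 + sum_norm n x) ^ k * (1 + sum_norm n y) ^ k) * sum_norm n (\<lambda>i. x i - y i)))"

lemma sum_norm_nonneg [simp]: "0 \<le> sum_norm n x"
  by (simp add: sum_norm_def sum_nonneg)

lemma tuple_norm_nonneg: "0 \<le> tuple_norm n x"
  by (simp add: tuple_norm_def L2_set_nonneg)

lemma tuple_norm_le_sum_norm: "tuple_norm n x \<le> sum_norm n x"
  unfolding tuple_norm_def sum_norm_def by (rule L2_set_le_sum) simp

lemma sum_norm_le_tuple_norm: "sum_norm n x \<le> real n * tuple_norm n x"
proof -
  have "norm (x i) \<le> tuple_norm n x" if "i < n" for i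
    unfolding tuple_norm_def using that by (intro member_le_L2_set[of "{..<n}" i "\<lambda>i. norm (x i)"]) auto
  then have "sum_norm n x \<le> (\<Sum>i<n. tuple_norm n x)"
    unfolding sum_norm_def by (intro sum_mono) auto
  then show ?thesis by simp
qed

lemma sum_norm_triangle: "sum_norm n x \<le> sum_norm n (\<lambda>i. x i - y i) + sum_norm n y"
  unfolding sum_norm_def sum.distrib[symmetric]
  by (intro sum_mono) (metis diff_add_cancel norm_triangle_ineq)

lemma sum_norm_mono: "m \<le> n \<Longrightarrow> sum_norm m x \<le> sum_norm n x"
  unfolding sum_norm_def by (intro sum_mono2) auto

text \<open>\<open>1 + m\<close> is at most twice the larger of 1 and \<open>m\<close>.\<close>

lemma one_plus_pow_le: "(1 + m) ^ k \<le> 2 ^ k * (1 + m ^ k)" if "m \<ge> 0" for m :: real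
proof (cases "m \<le> 1")
  case True
  then have "(1 + m) ^ k \<le> 2 ^ k" using that by (intro power_mono) auto
  then show ?thesis using that by (auto simp: distrib_left intro: add_increasing2)
next
  case False
  then have "(1 + m) ^ k \<le> (2 * m) ^ k" using that by (intro power_mono) auto
  then show ?thesis by (simp add: distrib_left power_mult_distrib add_increasing)
qed

lemma C_l_lip_iff: "f \<in> C_l_lip n \<longleftrightarrow> poly_lip n f"
proof
  assume "f \<in> C_l_lip n"
  then obtain L q where L: "L > 0" "q \<ge> 1" and
    f: "\<And>x y. \<bar>f x - f y\<bar> \<le> L * (1 + tuple_norm n x powr q + tuple_norm n y powr q) * tuple_norm n (\<lambda>i. x i - y i)"
    unfolding C_l_lip_def by blast
  \<comment> \<open>Rounding the exponent up is harmless since the base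
    \<open>1 + sum_norm n x\<close> is at least 1.\<close>
  define k where "k = nat \<lceil>q\<rceil>"
  have qk: "q \<le> real k" using L unfolding k_def by linarith
  have pw: "tuple_norm n x powr q \<le> (1 + sum_norm n x) ^ k" for x :: "nat \<Rightarrow> 'a"
  proof -
    have "tuple_norm n x powr q \<le> (1 + sum_norm n x) powr q"
      using tuple_norm_le_sum_norm[of n x] tuple_norm_nonneg[of n x] L
      by (intro powr_mono2) auto
    also have "\<dots> \<le> (1 + sum_norm n x) powr real k"
      by (intro powr_mono qk) auto
    also have "\<dots> = (1 + sum_norm n x) ^ k"
      by (intro powr_realpow) (use sum_norm_nonneg[of n x] in linarith)
    finally show ?thesis .
  qed
  show "poly_lip n f" unfolding poly_lip_def
  proof (intro exI conjI allI)
    show "0 \<le> L * 3" using L by simp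
    fix x y :: "nat \<Rightarrow> 'a"
    define u v where "u = (1 + sum_norm n x) ^ k" and "v = (1 + sum_norm n y) ^ k"
    have uv: "1 \<le> u" "1 \<le> v" by (simp_all add: u_def v_def)
    have "1 + tuple_norm n x powr q + tuple_norm n y powr q \<le> 1 + u + v"
      using pw[of x] pw[of y] by (simp add: u_def v_def)
    also have "\<dots> \<le> 3 * (u * v)"
    proof -
      have "u \<le> u * v" "v \<le> u * v" using uv by auto
      with uv show ?thesis by linarith
    qed
    finally have "L * (1 + tuple_norm n x powr q + tuple_norm n y powr q) * tuple_norm n (\<lambda>i. x i - y i)
       \<le> L * (3 * (u * v)) * sum_norm n (\<lambda>i. x i - y i)"
      using L uv by (intro mult_mono mult_left_mono tuple_norm_le_sum_norm) (auto simp: tuple_norm_nonneg)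
    with f[of x y] show "\<bar>f x - f y\<bar> \<le> L * 3 * ((1 + sum_norm n x) ^ k * (1 + sum_norm n y) ^ k) * sum_norm n (\<lambda>i. x i - y i)"
      by (simp add: u_def v_def mult.assoc)
  qed
next
  assume "poly_lip n f"
  then obtain C k where C: "C \<ge> 0" and
    f: "\<And>x y. \<bar>f x - f y\<bar> \<le> C * ((1 + sum_norm n x) ^ k * (1 + sum_norm n y) ^ k) * sum_norm n (\<lambda>i. x i - y i)"
    unfolding poly_lip_def by blast
  \<comment> \<open>Two weights of degree \<open>k\<close>, both bounded through the larger norm,
    give degree \<open>2 * k\<close>; one more power in each ensures \<open>q \<ge> 1\<close> when
    \<open>k = 0\<close>.\<close>
  define q where "q = 2 * Suc k"
  define K where "K = real (Suc n) ^ q * 2 ^ q"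
  have K0: "K \<ge> 0" by (simp add: K_def)
  have bd: "(1 + sum_norm n x) ^ k * (1 + sum_norm n y) ^ k
     \<le> K * (1 + tuple_norm n x powr real q + tuple_norm n y powr real q)" for x y :: "nat \<Rightarrow> 'a"
  proof -
    define m where "m = max (tuple_norm n x) (tuple_norm n y)"
    have m0: "m \<ge> 0" using tuple_norm_nonneg[of n x] by (simp add: m_def)
    have le: "1 + sum_norm n z \<le> real (Suc n) * (1 + m)" if "z = x \<or> z = y" for z
    proof -
      have "sum_norm n z \<le> real n * m"
        by (rule order_trans[OF sum_norm_le_tuple_norm]) (use that in \<open>auto simp: m_def intro: mult_left_mono\<close>)
      then show ?thesis using m0 by (simp add: algebra_simps)
    qed
    have "(1 + sum_norm n x) ^ k * (1 + sum_norm n y) ^ k \<le> (1 + sum_norm n x) ^ Suc k * (1 + sum_norm n y) ^ Suc k"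
      by (intro mult_mono power_increasing) auto
    also have "\<dots> \<le> (real (Suc n) * (1 + m)) ^ Suc k * (real (Suc n) * (1 + m)) ^ Suc k"
      by (intro mult_mono power_mono le) (use m0 in \<open>auto intro!: mult_nonneg_nonneg zero_le_power add_nonneg_nonneg\<close>)
    also have "\<dots> = real (Suc n) ^ q * (1 + m) ^ q"
      unfolding q_def power_add[symmetric] mult_2 by (simp only: power_mult_distrib)
    also have "\<dots> \<le> real (Suc n) ^ q * (2 ^ q * (1 + m ^ q))"
      by (intro mult_left_mono one_plus_pow_le m0) auto
    also have "\<dots> = K * (1 + m ^ q)" by (simp add: K_def)
    also have "\<dots> \<le> K * (1 + tuple_norm n x ^ q + tuple_norm n y ^ q)"
      using K0 tuple_norm_nonneg[of n x] tuple_norm_nonneg[of n y]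
      by (intro mult_left_mono) (auto simp: m_def max_def)
    also have "tuple_norm n x ^ q = tuple_norm n x powr real q"
      using tuple_norm_nonneg[of n x] by (subst powr_realpow') (auto simp: q_def)
    also have "tuple_norm n y ^ q = tuple_norm n y powr real q"
      using tuple_norm_nonneg[of n y] by (subst powr_realpow') (auto simp: q_def)
    finally show ?thesis .
  qed
  show "f \<in> C_l_lip n" unfolding C_l_lip_def
  proof (intro CollectI exI conjI allI)
    \<comment> \<open>The summand 1 keeps the constant positive when \<open>C\<close> or
      \<open>n\<close> vanishes.\<close>
    show "0 < C * K * real n + 1" using C K0 by (simp add: add_nonneg_pos)
    show "1 \<le> real q" by (simp add: q_def)
    fix x y :: "nat \<Rightarrow> 'a"
    define T where "T = 1 + tuple_norm n x powr real q + tuple_norm n y powr real q"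
    have T: "T \<ge> 0" by (simp add: T_def add_nonneg_nonneg)
    have "\<bar>f x - f y\<bar> \<le> C * (K * T) * (real n * tuple_norm n (\<lambda>i. x i - y i))"
      by (rule order_trans[OF f]) (use C K0 T in \<open>auto simp: T_def intro!: mult_mono bd sum_norm_le_tuple_norm mult_left_mono\<close>)
    also have "\<dots> = C * K * real n * T * tuple_norm n (\<lambda>i. x i - y i)" by simp
    also have "\<dots> \<le> (C * K * real n + 1) * T * tuple_norm n (\<lambda>i. x i - y i)"
      using T by (intro mult_right_mono) (auto simp: tuple_norm_nonneg)
    finally show "\<bar>f x - f y\<bar> \<le> (C * K * real n + 1) * (1 + tuple_norm n x powr real q + tuple_norm n y powr real q) * tuple_norm n (\<lambda>i. x i - y i)"
      by (simp add: T_def)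
  qed
qed

text \<open>The last factor of the growth bound vanishes. This disposes of all differences in
  irrelevant entries, as they arise from \<open>tuple_append\<close> and from updates.\<close>

lemma poly_lip_cong_on:
  assumes "poly_lip n f" "\<And>i. i < n \<Longrightarrow> x i = y i"
  shows "f x = f y"
proof -
  have "sum_norm n (\<lambda>i. x i - y i) = 0" using assms(2) by (simp add: sum_norm_def)
  with assms(1) have "\<bar>f x - f y\<bar> \<le> 0" unfolding poly_lip_def by (metis mult_zero_right)
  then show ?thesis by simp
qed

section \<open>Closure properties of the class of test functions\<close>

lemma poly_lipI:
  assumes "C \<ge> 0"
    and "\<And>x y. \<bar>f x - f y\<bar> \<le> C * ((1 + sum_norm n x) ^ k * (1 + sum_norm n y) ^ k) * sum_norm n (\<lambda>i. x i - y i)"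
  shows "poly_lip n f"
  unfolding poly_lip_def using assms by blast

lemma poly_lipI_Lipschitz:
  assumes "C \<ge> 0" and "\<And>x y. \<bar>f x - f y\<bar> \<le> C * sum_norm n (\<lambda>i. x i - y i)"
  shows "poly_lip n f"
  by (rule poly_lipI[of C _ _ 0]) (use assms in auto)

lemma poly_lip_const: "poly_lip n (\<lambda>_. c)"
  by (rule poly_lipI_Lipschitz[of 0]) auto

lemma poly_lip_norm_coord: "i < n \<Longrightarrow> poly_lip n (\<lambda>x. norm (x i))"
proof (rule poly_lipI_Lipschitz[of 1])
  fix x y :: "nat \<Rightarrow> 'a" assume "i < n"
  have "\<bar>norm (x i) - norm (y i)\<bar> \<le> norm (x i - y i)" by (rule norm_triangle_ineq3)
  also have "\<dots> \<le> sum_norm n (\<lambda>i. x i - y i)"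
    unfolding sum_norm_def using \<open>i < n\<close> by (intro member_le_sum) auto
  finally show "\<bar>norm (x i) - norm (y i)\<bar> \<le> 1 * sum_norm n (\<lambda>i. x i - y i)" by simp
qed simp

text \<open>Common source of the changes of coordinates: scaling, dropping, merging, assembling
  vectors from real entries. The weight of \<open>T x\<close> grows at most linearly in that of
  \<open>x\<close>; \<open>b\<close> collects the value of \<open>T\<close> at zero and the
  Lipschitz constant.\<close>

lemma poly_lip_comp_Lipschitz:
  fixes T :: "(nat \<Rightarrow> 'a::real_normed_vector) \<Rightarrow> nat \<Rightarrow> 'b::real_normed_vector"
  assumes f: "poly_lip n f" and K: "K \<ge> 0"
    and T: "\<And>x y. sum_norm n (\<lambda>i. T x i - T y i) \<le> K * sum_norm m (\<lambda>i. x i - y i)"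
  shows "poly_lip m (\<lambda>x. f (T x))"
proof -
  from f obtain C k where C: "C \<ge> 0" and
    f: "\<And>x y. \<bar>f x - f y\<bar> \<le> C * ((1 + sum_norm n x) ^ k * (1 + sum_norm n y) ^ k) * sum_norm n (\<lambda>i. x i - y i)"
    unfolding poly_lip_def by blast
  define b where "b = 1 + sum_norm n (T (\<lambda>_. 0)) + K"
  have b: "b \<ge> 0" by (simp add: b_def K add_nonneg_nonneg)
  have w: "1 + sum_norm n (T x) \<le> b * (1 + sum_norm m x)" for x
  proof -
    have "sum_norm n (T x) \<le> sum_norm n (\<lambda>i. T x i - T (\<lambda>_. 0) i) + sum_norm n (T (\<lambda>_. 0))"
      by (rule sum_norm_triangle)
    also have "\<dots> \<le> K * sum_norm m x + sum_norm n (T (\<lambda>_. 0))"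
      using T[of x "\<lambda>_. 0"] by simp
    finally have "1 + sum_norm n (T x) \<le> b + K * sum_norm m x" using K by (simp add: b_def)
    also have "\<dots> \<le> b + b * sum_norm m x"
      by (intro add_left_mono mult_right_mono) (auto simp: b_def)
    finally show ?thesis by (simp add: distrib_left)
  qed
  have wk: "(1 + sum_norm n (T x)) ^ k \<le> b ^ k * (1 + sum_norm m x) ^ k" for x
    unfolding power_mult_distrib[symmetric] by (intro power_mono w) (simp add: add_nonneg_nonneg)
  show ?thesis
  proof (rule poly_lipI[of "C * (b ^ k * b ^ k) * K" _ _ k])
    fix x y :: "nat \<Rightarrow> 'a"
    have "\<bar>f (T x) - f (T y)\<bar> \<le> C * ((1 + sum_norm n (T x)) ^ k * (1 + sum_norm n (T y)) ^ k) * sum_norm n (\<lambda>i. T x i - T y i)"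
      by (rule f)
    also have "\<dots> \<le> C * ((b ^ k * (1 + sum_norm m x) ^ k) * (b ^ k * (1 + sum_norm m y) ^ k)) * (K * sum_norm m (\<lambda>i. x i - y i))"
      by (intro mult_mono mult_left_mono wk T C) (auto intro!: mult_nonneg_nonneg simp: C b)
    finally show "\<bar>f (T x) - f (T y)\<bar> \<le> C * (b ^ k * b ^ k) * K * ((1 + sum_norm m x) ^ k * (1 + sum_norm m y) ^ k) * sum_norm m (\<lambda>i. x i - y i)"
      by (simp add: algebra_simps)
  qed (use C b K in auto)
qed

text \<open>All weights are at least 1, so passing to the maxima of the constants and of the
  exponents only weakens each bound.\<close>

lemma poly_lip_uniform:
  assumes "\<And>i. i < (m::nat) \<Longrightarrow> poly_lip n (g i)"
  obtains C k where "C \<ge> 0" "\<And>i x y. i < m \<Longrightarrow> \<bar>g i x - g i y\<bar>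
     \<le> C * ((1 + sum_norm n x) ^ k * (1 + sum_norm n y) ^ k) * sum_norm n (\<lambda>i. x i - y i)"
proof -
  have "\<exists>C k. C \<ge> 0 \<and> (\<forall>i<m. \<forall>x y. \<bar>g i x - g i y\<bar>
     \<le> C * ((1 + sum_norm n x) ^ k * (1 + sum_norm n y) ^ k) * sum_norm n (\<lambda>i. x i - y i))"
    using assms
  proof (induction m)
    case 0
    then show ?case by auto
  next
    case (Suc m)
    then obtain C k where C: "C \<ge> 0" and
      g: "\<And>i x y. i < m \<Longrightarrow> \<bar>g i x - g i y\<bar> \<le> C * ((1 + sum_norm n x) ^ k * (1 + sum_norm n y) ^ k) * sum_norm n (\<lambda>i. x i - y i)"
      by fastforce
    from Suc.prems[of m] obtain C' k' where C': "C' \<ge> 0" and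
      g': "\<And>x y. \<bar>g m x - g m y\<bar> \<le> C' * ((1 + sum_norm n x) ^ k' * (1 + sum_norm n y) ^ k') * sum_norm n (\<lambda>i. x i - y i)"
      unfolding poly_lip_def by auto
    have mono: "D * ((1 + sum_norm n x) ^ l * (1 + sum_norm n y) ^ l) * sum_norm n (\<lambda>i. x i - y i)
       \<le> max C C' * ((1 + sum_norm n x) ^ max k k' * (1 + sum_norm n y) ^ max k k') * sum_norm n (\<lambda>i. x i - y i)"
      if "0 \<le> D" "D \<le> max C C'" "l \<le> max k k'" for D l and x y :: "nat \<Rightarrow> 'a"
      using that by (intro mult_right_mono mult_mono power_increasing) auto
    show ?case
    proof (intro exI conjI allI impI)
      show "0 \<le> max C C'" using C by simp
      fix i x y assume "i < Suc m"
      then show "\<bar>g i x - g i y\<bar> \<le> max C C' * ((1 + sum_norm n x) ^ max k k' * (1 + sum_norm n y) ^ max k k') * sum_norm n (\<lambda>i. x i - y i)"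
        using order_trans[OF g mono[of C k x y]] order_trans[OF g' mono[of C' k' x y]] C C'
        by (cases "i = m") auto
    qed
  qed
  then show thesis using that by blast
qed

text \<open>Each \<open>g i\<close> has growth of degree \<open>Suc k\<close>, one more than its
  Lipschitz weight, because the distance to its value at zero brings a factor
  \<open>sum_norm n x\<close>. The outer weight thus gets degree \<open>Suc k * p\<close>, and the
  difference of the inner values adds \<open>k\<close>.\<close>

lemma poly_lip_comp:
  assumes f: "poly_lip m f" and g: "\<And>i. i < m \<Longrightarrow> poly_lip n (g i)"
  shows "poly_lip n (\<lambda>x. f (\<lambda>i. g i x :: real))"
proof -
  from f obtain A p where A: "A \<ge> 0" and
    f: "\<And>x y. \<bar>f x - f y\<bar> \<le> A * ((1 + sum_norm m x) ^ p * (1 + sum_norm m y) ^ p) * sum_norm m (\<lambda>i. x i - y i)"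
    unfolding poly_lip_def by blast
  obtain C k where C: "C \<ge> 0" and
    g: "\<And>i x y. i < m \<Longrightarrow> \<bar>g i x - g i y\<bar> \<le> C * ((1 + sum_norm n x) ^ k * (1 + sum_norm n y) ^ k) * sum_norm n (\<lambda>i. x i - y i)"
    using poly_lip_uniform[of m n g] assms(2) by blast
  have gs: "sum_norm m (\<lambda>i. g i x - g i y) \<le> (m * C) * ((1 + sum_norm n x) ^ k * (1 + sum_norm n y) ^ k) * sum_norm n (\<lambda>i. x i - y i)" for x y
  proof -
    have "sum_norm m (\<lambda>i. g i x - g i y) \<le> (\<Sum>i<m. C * ((1 + sum_norm n x) ^ k * (1 + sum_norm n y) ^ k) * sum_norm n (\<lambda>i. x i - y i))"
      unfolding sum_norm_def[of m] by (intro sum_mono) (use g in auto)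
    then show ?thesis by (simp add: algebra_simps)
  qed
  define b where "b = 1 + sum_norm m (\<lambda>i. g i (\<lambda>_. 0)) + m * C"
  have b: "b \<ge> 0" by (simp add: b_def C add_nonneg_nonneg)
  have w: "1 + sum_norm m (\<lambda>i. g i x) \<le> b * (1 + sum_norm n x) ^ Suc k" for x
  proof -
    have "sum_norm m (\<lambda>i. g i x) \<le> sum_norm m (\<lambda>i. g i x - g i (\<lambda>_. 0)) + sum_norm m (\<lambda>i. g i (\<lambda>_. 0))"
      by (rule sum_norm_triangle)
    also have "\<dots> \<le> m * C * (1 + sum_norm n x) ^ k * sum_norm n x + sum_norm m (\<lambda>i. g i (\<lambda>_. 0))"
      using gs[of x "\<lambda>_. 0"] by (simp add: sum_norm_def)
    also have "m * C * (1 + sum_norm n x) ^ k * sum_norm n x \<le> m * C * (1 + sum_norm n x) ^ k * (1 + sum_norm n x)"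
      by (intro mult_left_mono) (auto intro!: mult_nonneg_nonneg simp: C)
    finally have *: "1 + sum_norm m (\<lambda>i. g i x) \<le> (1 + sum_norm m (\<lambda>i. g i (\<lambda>_. 0))) + m * C * (1 + sum_norm n x) ^ Suc k"
      by (simp add: mult_ac)
    have "1 \<le> (1 + sum_norm n x) ^ Suc k" by (rule one_le_power) simp
    then have "(1 + sum_norm m (\<lambda>i. g i (\<lambda>_. 0))) * 1 \<le> (1 + sum_norm m (\<lambda>i. g i (\<lambda>_. 0))) * (1 + sum_norm n x) ^ Suc k"
      by (intro mult_left_mono) (auto simp: add_nonneg_nonneg)
    with * show ?thesis unfolding b_def by (simp only: distrib_right)
  qed
  have wk: "(1 + sum_norm m (\<lambda>i. g i x)) ^ p \<le> b ^ p * (1 + sum_norm n x) ^ (Suc k * p)" for x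
    unfolding power_mult power_mult_distrib[symmetric]
    by (intro power_mono) (use w[of x] in \<open>auto simp: add_nonneg_nonneg\<close>)
  show ?thesis
  proof (rule poly_lipI[of "A * (b ^ p * b ^ p) * (m * C)" _ _ "Suc k * p + k"])
    fix x y :: "nat \<Rightarrow> 'a"
    have "\<bar>f (\<lambda>i. g i x) - f (\<lambda>i. g i y)\<bar> \<le> A * ((1 + sum_norm m (\<lambda>i. g i x)) ^ p * (1 + sum_norm m (\<lambda>i. g i y)) ^ p) * sum_norm m (\<lambda>i. g i x - g i y)"
      by (rule f)
    also have "\<dots> \<le> A * ((b ^ p * (1 + sum_norm n x) ^ (Suc k * p)) * (b ^ p * (1 + sum_norm n y) ^ (Suc k * p))) * ((m * C) * ((1 + sum_norm n x) ^ k * (1 + sum_norm n y) ^ k) * sum_norm n (\<lambda>i. x i - y i))"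
      by (intro mult_mono mult_left_mono wk gs A) (auto intro!: mult_nonneg_nonneg simp: A b)
    also have "\<dots> = A * (b ^ p * b ^ p) * (m * C) * ((1 + sum_norm n x) ^ (Suc k * p + k) * (1 + sum_norm n y) ^ (Suc k * p + k)) * sum_norm n (\<lambda>i. x i - y i)"
      unfolding power_add by (simp only: mult_ac)
    finally show "\<bar>f (\<lambda>i. g i x) - f (\<lambda>i. g i y)\<bar> \<le> A * (b ^ p * b ^ p) * (m * C) * ((1 + sum_norm n x) ^ (Suc k * p + k) * (1 + sum_norm n y) ^ (Suc k * p + k)) * sum_norm n (\<lambda>i. x i - y i)" .
  qed (use A b C in auto)
qed

lemma poly_lip_add_real: "poly_lip 2 (\<lambda>x. x 0 + x 1 :: real)"
  by (rule poly_lipI_Lipschitz[of 1]) (auto simp: sum_norm_def numeral_2_eq_2)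

text \<open>Not globally Lipschitz: the factors \<open>x 0\<close> and \<open>y 1\<close> of the
  split difference are absorbed by first powers of the weights.\<close>

lemma poly_lip_mult_real: "poly_lip 2 (\<lambda>x. x 0 * x 1 :: real)"
proof (rule poly_lipI[of 1 _ _ 1])
  fix x y :: "nat \<Rightarrow> real"
  define M where "M = (1 + sum_norm 2 x) * (1 + sum_norm 2 y)"
  have M: "\<bar>x 0\<bar> \<le> M" "\<bar>y 1\<bar> \<le> M"
    by (auto simp: M_def sum_norm_def numeral_2_eq_2 algebra_simps add_nonneg_nonneg)
  have "\<bar>x 0 * x 1 - y 0 * y 1\<bar> = \<bar>x 0 * (x 1 - y 1) + (x 0 - y 0) * y 1\<bar>"
    by (simp add: algebra_simps)
  also have "\<dots> \<le> \<bar>x 0\<bar> * \<bar>x 1 - y 1\<bar> + \<bar>x 0 - y 0\<bar> * \<bar>y 1\<bar>"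
    by (rule order_trans[OF abs_triangle_ineq]) (simp add: abs_mult)
  also have "\<dots> \<le> M * \<bar>x 1 - y 1\<bar> + \<bar>x 0 - y 0\<bar> * M"
    by (intro add_mono mult_left_mono mult_right_mono M) auto
  also have "\<dots> = M * sum_norm 2 (\<lambda>i. x i - y i)"
    by (simp add: sum_norm_def numeral_2_eq_2 algebra_simps)
  finally show "\<bar>x 0 * x 1 - y 0 * y 1\<bar> \<le> 1 * ((1 + sum_norm 2 x) ^ 1 * (1 + sum_norm 2 y) ^ 1) * sum_norm 2 (\<lambda>i. x i - y i)"
    by (simp add: M_def)
qed simp

lemma poly_lip_add: "poly_lip n f \<Longrightarrow> poly_lip n g \<Longrightarrow> poly_lip n (\<lambda>x. f x + g x)"
  using poly_lip_comp[OF poly_lip_add_real, where g = "\<lambda>i. if i = 0 then f else g"] by simp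

lemma poly_lip_mult: "poly_lip n f \<Longrightarrow> poly_lip n g \<Longrightarrow> poly_lip n (\<lambda>x. f x * g x)"
  using poly_lip_comp[OF poly_lip_mult_real, where g = "\<lambda>i. if i = 0 then f else g"] by simp

lemma poly_lip_power: "poly_lip n f \<Longrightarrow> poly_lip n (\<lambda>x. f x ^ k)"
  by (induction k) (auto intro: poly_lip_const poly_lip_mult)

lemma poly_lip_diff: "poly_lip n f \<Longrightarrow> poly_lip n g \<Longrightarrow> poly_lip n (\<lambda>x. f x - g x)"
  using poly_lip_add[of n f "\<lambda>x. -1 * g x"] poly_lip_mult[OF poly_lip_const[of n "-1"], of g] by simp

lemma poly_lip_abs_real: "poly_lip 1 (\<lambda>x. \<bar>x 0\<bar> :: real)"
  using poly_lip_norm_coord[of 0 1, where 'a = real] by simp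

lemma poly_lip_abs: "poly_lip n f \<Longrightarrow> poly_lip n (\<lambda>x. \<bar>f x\<bar>)"
  using poly_lip_comp[OF poly_lip_abs_real, where g = "\<lambda>i. f"] by simp

section \<open>The iterated sublinear expectation\<close>

lemma eq_dist_E:
  assumes "eq_dist E X Y" "poly_lip 1 (\<lambda>x. g (x 0))"
  shows "E (\<lambda>w. g (X w)) = E (\<lambda>w. g (Y w))"
  using bspec[OF assms(1)[unfolded eq_dist_def] assms(2)[folded C_l_lip_iff]] .

lemma indep_from_E:
  assumes "indep_from E n Y m X" "poly_lip (m + n) f"
  shows "E (\<lambda>w. f (tuple_append m (X w) (Y w))) = E (\<lambda>w. E (\<lambda>v. f (tuple_append m (X w) (Y v))))"
  using assms by (auto simp: indep_from_def C_l_lip_iff)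

context sublinear_expectation
begin

lemma poly_lip_comp_mem:
  assumes "poly_lip k f" "\<And>i. i < k \<Longrightarrow> Z i \<in> H"
  shows "(\<lambda>w. f (\<lambda>i. Z i w)) \<in> H"
  using comp_mem assms by (auto simp: C_l_lip_iff)

lemma diff_mem: "X \<in> H \<Longrightarrow> Y \<in> H \<Longrightarrow> (\<lambda>w. X w - Y w) \<in> H"
  using add_mem[of X "\<lambda>w. -1 * Y w"] scale_mem[of Y "-1"] by simp

text \<open>Multiplication is itself a test function, so the lattice is an algebra; second moments
  depend on this.\<close>

lemma mult_mem: "X \<in> H \<Longrightarrow> Y \<in> H \<Longrightarrow> (\<lambda>w. X w * Y w) \<in> H"
  using poly_lip_comp_mem[OF poly_lip_mult_real, of "\<lambda>i. if i = 0 then X else Y"] by simp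

lemma square_mem: "X \<in> H \<Longrightarrow> (\<lambda>w. (X w)\<^sup>2) \<in> H"
  unfolding power2_eq_square by (rule mult_mem)

lemma neg_part_mem: "X \<in> H \<Longrightarrow> (\<lambda>w. max (- X w) 0) \<in> H"
proof -
  assume X: "X \<in> H"
  have "(\<lambda>w. (1/2) * (\<bar>X w\<bar> - X w)) \<in> H" by (intro scale_mem diff_mem abs_mem X)
  also have "(\<lambda>w. (1/2) * (\<bar>X w\<bar> - X w)) = (\<lambda>w. max (- X w) 0)" by (auto simp: max_def abs_if)
  finally show ?thesis .
qed

lemma E_nonneg: "X \<in> H \<Longrightarrow> (\<And>w. 0 \<le> X w) \<Longrightarrow> 0 \<le> E X"
  using mono[OF const_mem, of X 0] const[of 0] by simp

text \<open>Subadditivity for \<open>X = (X - Y) + Y\<close>, the substitute for linearity.\<close>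

lemma E_diff_le: "X \<in> H \<Longrightarrow> Y \<in> H \<Longrightarrow> E X - E Y \<le> E (\<lambda>w. X w - Y w)"
  using subadd[OF diff_mem[of X Y], of Y] by simp

lemma abs_E_diff_le:
  assumes "X \<in> H" "Y \<in> H"
  shows "\<bar>E X - E Y\<bar> \<le> E (\<lambda>w. \<bar>X w - Y w\<bar>)"
proof -
  have "E X - E Y \<le> E (\<lambda>w. \<bar>X w - Y w\<bar>)" if "X \<in> H" "Y \<in> H" for X Y
    using E_diff_le[OF that] mono[OF diff_mem[OF that] abs_mem[OF diff_mem[OF that]]] by force
  from this[OF assms] this[OF assms(2,1)] show ?thesis by (simp add: abs_minus_commute abs_le_iff)
qed

text \<open>\<open>comp_mem\<close> composes with real random variables only. The \<open>m\<close>
  vectors are therefore flattened into \<open>m * CARD('d)\<close> reals, coordinate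
  \<open>j\<close> of vector \<open>i\<close> at position \<open>i * CARD('d) + e j\<close>, and
  \<open>T\<close> reassembles them.\<close>

lemma poly_lip_random_vectors_mem:
  fixes X :: "nat \<Rightarrow> 'w \<Rightarrow> real ^ 'd"
  assumes f: "poly_lip m f" and X: "\<And>i. i < m \<Longrightarrow> random_vector H (X i)"
  shows "(\<lambda>w. f (\<lambda>i. X i w)) \<in> H"
proof -
  let ?D = "CARD('d)"
  obtain e where e: "bij_betw e (UNIV :: 'd set) {..<?D}"
    using ex_bij_betw_finite_nat[of "UNIV :: 'd set"] by (auto simp: atLeast0LessThan)
  define e' where "e' = inv_into UNIV e"
  have e'e: "e' (e j) = j" for j
    using e unfolding e'_def bij_betw_def by (simp add: inv_into_f_f)
  have eD: "e j < ?D" for j using e by (auto simp: bij_betw_def)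
  define T where "T = (\<lambda>(z :: nat \<Rightarrow> real) i. (\<chi> j. z (i * ?D + e j)) :: real ^ 'd)"
  have "poly_lip (m * ?D) (\<lambda>z. f (T z))"
  proof (rule poly_lip_comp_Lipschitz[OF f, of 1])
    fix x y :: "nat \<Rightarrow> real"
    have "sum_norm m (\<lambda>i. T x i - T y i) \<le> (\<Sum>i<m. \<Sum>j\<in>UNIV. \<bar>x (i * ?D + e j) - y (i * ?D + e j)\<bar>)"
      unfolding sum_norm_def
      by (intro sum_mono order_trans[OF norm_le_l1_cart]) (simp add: T_def)
    also have "\<dots> = (\<Sum>i<m. \<Sum>k<?D. \<bar>x (i * ?D + k) - y (i * ?D + k)\<bar>)"
      by (intro sum.cong refl sum.reindex_bij_betw[OF e, of "\<lambda>k. \<bar>x (_ * ?D + k) - y (_ * ?D + k)\<bar>"])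
    also have "\<dots> = (\<Sum>i<m. sum (\<lambda>k. \<bar>x k - y k\<bar>) {i * ?D..<i * ?D + ?D})"
      by (simp add: sum.atLeastLessThan_shift_0[of _ "_ * ?D" "_ * ?D + ?D"] atLeast0LessThan)
    also have "\<dots> = sum (\<lambda>k. \<bar>x k - y k\<bar>) {..<m * ?D}" by (rule sum.nat_group)
    finally show "sum_norm m (\<lambda>i. T x i - T y i) \<le> 1 * sum_norm (m * ?D) (\<lambda>i. x i - y i)"
      by (simp add: sum_norm_def)
  qed simp
  then have "(\<lambda>w. f (T (\<lambda>k. X (k div ?D) w $ e' (k mod ?D)))) \<in> H"
  proof (rule poly_lip_comp_mem)
    fix k assume "k < m * ?D"
    then have "k div ?D < m" by (simp add: less_mult_imp_div_less)
    from X[OF this] show "(\<lambda>w. X (k div ?D) w $ e' (k mod ?D)) \<in> H"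
      by (simp add: random_vector_def)
  qed
  also have "(\<lambda>w. f (T (\<lambda>k. X (k div ?D) w $ e' (k mod ?D)))) = (\<lambda>w. f (\<lambda>i. X i w))"
    by (intro ext arg_cong[of _ _ f]) (simp add: T_def vec_eq_iff eD e'e)
  finally show ?thesis .
qed

lemma poly_lip_random_vector_mem:
  assumes "poly_lip 1 (\<lambda>x. g (x 0))" "random_vector H X"
  shows "(\<lambda>w. g (X w)) \<in> H"
  using poly_lip_random_vectors_mem[OF assms(1), of "\<lambda>_. X"] assms(2) by simp

lemma random_vector_scaleR:
  "random_vector H X \<Longrightarrow> random_vector H (\<lambda>w. c *\<^sub>R X w)"
  unfolding random_vector_def by (simp add: scale_mem)

end

lemma poly_lip_fun_upd_scaleR:
  assumes "poly_lip (Suc n) f"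
  shows "poly_lip 1 (\<lambda>z. f (x(n := c *\<^sub>R z 0)))"
proof (rule poly_lip_comp_Lipschitz[OF assms, of "\<bar>c\<bar>"])
  fix y z :: "nat \<Rightarrow> 'a"
  have "sum_norm (Suc n) (\<lambda>i. (x(n := c *\<^sub>R y 0)) i - (x(n := c *\<^sub>R z 0)) i) = norm (c *\<^sub>R (y 0 - z 0))"
    by (simp add: sum_norm_def scaleR_diff_right)
  then show "sum_norm (Suc n) (\<lambda>i. (x(n := c *\<^sub>R y 0)) i - (x(n := c *\<^sub>R z 0)) i) \<le> \<bar>c\<bar> * sum_norm 1 (\<lambda>i. y i - z i)"
    by (simp add: sum_norm_def)
qed simp

lemma poly_lip_scaleR_coords:
  assumes "poly_lip n f"
  shows "poly_lip n (\<lambda>x. f (\<lambda>i. c i *\<^sub>R x i))"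
proof (rule poly_lip_comp_Lipschitz[OF assms, of "\<Sum>i<n. \<bar>c i\<bar>"])
  fix x y :: "nat \<Rightarrow> 'a::real_normed_vector"
  have "sum_norm n (\<lambda>i. c i *\<^sub>R x i - c i *\<^sub>R y i) = (\<Sum>i<n. \<bar>c i\<bar> * norm (x i - y i))"
    by (simp add: sum_norm_def scaleR_diff_right[symmetric])
  also have "\<dots> \<le> (\<Sum>i<n. (\<Sum>i<n. \<bar>c i\<bar>) * norm (x i - y i))"
    by (intro sum_mono mult_right_mono member_le_sum) auto
  finally show "sum_norm n (\<lambda>i. c i *\<^sub>R x i - c i *\<^sub>R y i) \<le> (\<Sum>i<n. \<bar>c i\<bar>) * sum_norm n (\<lambda>i. x i - y i)"
    by (simp add: sum_norm_def sum_distrib_left)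
qed (simp add: sum_nonneg)

text \<open>The map from the increments over a partition with one inserted interior point to those
  over the original partition.\<close>

definition merge_coords :: "nat \<Rightarrow> (nat \<Rightarrow> 'a::plus) \<Rightarrow> nat \<Rightarrow> 'a" where
  "merge_coords j x i = (if i < j then x i else if i = j then x j + x (Suc j) else x (Suc i))"

lemma tuple_append_fun_upd:
  "tuple_append m x (y(n := z)) = (tuple_append m x y)(m + n := z)"
  by (rule ext) (auto simp: tuple_append_def)

locale G_normal_sequence = sublinear_expectation H E
  for H :: "('w \<Rightarrow> real) set" and E +
  fixes G :: "real ^ 'd ^ 'd \<Rightarrow> real" and \<xi> :: "nat \<Rightarrow> 'w \<Rightarrow> real ^ 'd::finite"
  assumes G_normal: "G_normal H E G (\<xi> i)"
    and eq_dist: "eq_dist E (\<xi> i) (\<xi> j)"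
    and indep: "i \<ge> 1 \<Longrightarrow> indep_from E 1 (\<lambda>w _. \<xi> i w) i (\<lambda>w k. \<xi> k w)"
begin

lemma rv_xi: "random_vector H (\<xi> i)"
  using G_normal by (simp add: G_normal_def)

text \<open>By independence the joint law of \<open>sqrt (a i) *\<^sub>R \<xi> i\<close> for \<open>i < n\<close> is an iterated expectation
  under the law of \<open>\<xi> 0\<close> alone, the coordinate \<open>n - 1\<close> being integrated first. All
  consistency properties reduce to this form, since it does not refer to the index of \<open>\<xi> i\<close>.\<close>

definition integrate_coord :: "real \<Rightarrow> nat \<Rightarrow> ((nat \<Rightarrow> real ^ 'd) \<Rightarrow> real) \<Rightarrow> (nat \<Rightarrow> real ^ 'd) \<Rightarrow> real" where
  "integrate_coord a n f x = E (\<lambda>w. f (x(n := sqrt a *\<^sub>R \<xi> 0 w)))"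

text \<open>The zero sequence is a default value: once all \<open>n\<close> coordinates of a test
  function are integrated out, a constant remains.\<close>

primrec iter_E :: "(nat \<Rightarrow> real) \<Rightarrow> nat \<Rightarrow> ((nat \<Rightarrow> real ^ 'd) \<Rightarrow> real) \<Rightarrow> real" where
  "iter_E a 0 f = f (\<lambda>_. 0)"
| "iter_E a (Suc n) f = iter_E a n (integrate_coord (a n) n f)"

lemma integrand_mem: "poly_lip (Suc n) f \<Longrightarrow> (\<lambda>w. f (x(n := sqrt a *\<^sub>R \<xi> i w))) \<in> H"
  by (rule poly_lip_random_vector_mem[OF poly_lip_fun_upd_scaleR rv_xi])

text \<open>The weight at \<open>x(n := z)\<close> is at most the weight at \<open>x\<close> times
  \<open>1 + norm z\<close>, so growth in the integrated variable factors out as the moment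
  \<open>E ?Z\<close>. The two factors of \<open>?Z\<close> stem from the weights at
  \<open>x\<close> and at \<open>y\<close>.\<close>

lemma poly_lip_integrate_coord:
  assumes "poly_lip (Suc n) f"
  shows "poly_lip n (integrate_coord a n f)"
proof -
  from assms obtain C k where C: "C \<ge> 0" and
    f: "\<And>x y. \<bar>f x - f y\<bar> \<le> C * ((1 + sum_norm (Suc n) x) ^ k * (1 + sum_norm (Suc n) y) ^ k) * sum_norm (Suc n) (\<lambda>i. x i - y i)"
    unfolding poly_lip_def by blast
  let ?Z = "\<lambda>w. (1 + norm (sqrt a *\<^sub>R \<xi> 0 w)) ^ k * (1 + norm (sqrt a *\<^sub>R \<xi> 0 w)) ^ k"
  have Z: "?Z \<in> H"
  proof (rule poly_lip_random_vector_mem[OF _ random_vector_scaleR[OF rv_xi]])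
    show "poly_lip 1 (\<lambda>x. (1 + norm (x 0 :: real ^ 'd)) ^ k * (1 + norm (x 0)) ^ k)"
      by (intro poly_lip_mult poly_lip_power poly_lip_add poly_lip_const poly_lip_norm_coord) auto
  qed
  have w: "(1 + sum_norm (Suc n) (x(n := z))) ^ k \<le> (1 + sum_norm n x) ^ k * (1 + norm z) ^ k" for x z
    unfolding power_mult_distrib[symmetric]
    by (intro power_mono) (auto simp: sum_norm_def algebra_simps sum_nonneg intro!: mult_nonneg_nonneg add_nonneg_nonneg)
  show ?thesis
  proof (rule poly_lipI[of "C * E ?Z" _ _ k])
    show "0 \<le> C * E ?Z" by (intro mult_nonneg_nonneg C E_nonneg Z) auto
    fix x y :: "nat \<Rightarrow> real ^ 'd"
    let ?c = "C * ((1 + sum_norm n x) ^ k * (1 + sum_norm n y) ^ k) * sum_norm n (\<lambda>i. x i - y i)"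
    have c: "?c \<ge> 0" by (intro mult_nonneg_nonneg C) auto
    have "\<bar>integrate_coord a n f x - integrate_coord a n f y\<bar>
        \<le> E (\<lambda>w. \<bar>f (x(n := sqrt a *\<^sub>R \<xi> 0 w)) - f (y(n := sqrt a *\<^sub>R \<xi> 0 w))\<bar>)"
      unfolding integrate_coord_def by (intro abs_E_diff_le integrand_mem assms)
    also have "\<dots> \<le> E (\<lambda>w. ?c * ?Z w)"
    proof (intro mono abs_mem diff_mem integrand_mem assms scale_mem Z)
      fix w
      let ?z = "sqrt a *\<^sub>R \<xi> 0 w"
      have "\<bar>f (x(n := ?z)) - f (y(n := ?z))\<bar> \<le> C * (((1 + sum_norm n x) ^ k * (1 + norm ?z) ^ k) * ((1 + sum_norm n y) ^ k * (1 + norm ?z) ^ k)) * sum_norm (Suc n) (\<lambda>i. (x(n := ?z)) i - (y(n := ?z)) i)"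
        by (rule order_trans[OF f]) (intro mult_right_mono mult_left_mono mult_mono w C; auto intro!: mult_nonneg_nonneg)
      also have "sum_norm (Suc n) (\<lambda>i. (x(n := ?z)) i - (y(n := ?z)) i) = sum_norm n (\<lambda>i. x i - y i)"
        by (simp add: sum_norm_def)
      finally show "\<bar>f (x(n := ?z)) - f (y(n := ?z))\<bar> \<le> ?c * ?Z w"
        by (simp only: mult_ac)
    qed
    also have "\<dots> = ?c * E ?Z" by (rule pos_hom[OF Z c])
    finally show "\<bar>integrate_coord a n f x - integrate_coord a n f y\<bar>
      \<le> C * E ?Z * ((1 + sum_norm n x) ^ k * (1 + sum_norm n y) ^ k) * sum_norm n (\<lambda>i. x i - y i)"
      by (simp only: mult_ac)
  qed
qed

text \<open>The last vector is independent from the earlier ones, so its expectation can be taken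
  inside; there its law may be replaced by that of \<open>\<xi> 0\<close>.\<close>

lemma E_eq_iter_E:
  "poly_lip n f \<Longrightarrow> E (\<lambda>w. f (\<lambda>i. sqrt (a i) *\<^sub>R \<xi> i w)) = iter_E a n f"
proof (induction n arbitrary: f)
  case 0
  then have "f x = f (\<lambda>_. 0)" for x by (rule poly_lip_cong_on) simp
  then have "f = (\<lambda>_. f (\<lambda>_. 0))" by blast
  then have "E (\<lambda>w. f (\<lambda>i. sqrt (a i) *\<^sub>R \<xi> i w)) = E (\<lambda>_. f (\<lambda>_. 0))" by metis
  then show ?case by (simp add: const)
next
  case (Suc n)
  \<comment> \<open>Independence is given for the unscaled vectors, so the scaling moves into the
    test function.\<close>
  let ?f = "\<lambda>x. f (\<lambda>i. sqrt (a i) *\<^sub>R x i)"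
  let ?s = "\<lambda>w i. sqrt (a i) *\<^sub>R \<xi> i w"
  have f': "poly_lip (Suc n) ?f" by (rule poly_lip_scaleR_coords[OF Suc.prems])
  have eqd: "E (\<lambda>v. f (x(n := sqrt (a n) *\<^sub>R \<xi> n v))) = integrate_coord (a n) n f x" for x
    unfolding integrate_coord_def
    by (rule eq_dist_E[OF eq_dist[of n 0] poly_lip_fun_upd_scaleR[OF Suc.prems, of x "sqrt (a n)"]])
  have "E (\<lambda>w. f (?s w)) = E (\<lambda>w. E (\<lambda>v. f ((?s w)(n := sqrt (a n) *\<^sub>R \<xi> n v))))"
  proof (cases "n = 0")
    \<comment> \<open>Independence is available from index 1 on; for a single vector the outer
      expectation is that of a constant.\<close>
    case True
    have "f ((?s w)(n := sqrt (a n) *\<^sub>R \<xi> n v)) = f (?s v)" for w v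
      by (rule poly_lip_cong_on[OF Suc.prems]) (simp add: True)
    then show ?thesis by (simp add: const)
  next
    case False
    have "E (\<lambda>w. f (?s w)) = E (\<lambda>w. ?f (tuple_append n (\<lambda>k. \<xi> k w) (\<lambda>_. \<xi> n w)))"
      by (intro arg_cong[of _ _ E] ext poly_lip_cong_on[OF Suc.prems]) (auto simp: tuple_append_def less_Suc_eq)
    also have "\<dots> = E (\<lambda>w. E (\<lambda>v. ?f (tuple_append n (\<lambda>k. \<xi> k w) (\<lambda>_. \<xi> n v))))"
      by (rule indep_from_E[OF indep]) (use False f' in auto)
    also have "\<dots> = E (\<lambda>w. E (\<lambda>v. f ((?s w)(n := sqrt (a n) *\<^sub>R \<xi> n v))))"
      by (rule arg_cong[of _ _ E], rule ext, rule arg_cong[of _ _ E], rule ext, rule poly_lip_cong_on[OF Suc.prems])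
        (auto simp: tuple_append_def less_Suc_eq)
    finally show ?thesis .
  qed
  also have "\<dots> = iter_E a (Suc n) f"
    using Suc.IH[OF poly_lip_integrate_coord[OF Suc.prems]] by (simp add: eqd)
  finally show ?case .
qed

text \<open>The semigroup property: independent increments over adjacent intervals of lengths
  \<open>a\<close> and \<open>b\<close> add up to an increment over length \<open>a + b\<close>.
  This is stability of the G-normal law with the factors \<open>sqrt a\<close> and
  \<open>sqrt b\<close>.\<close>

lemma integrate_coord_sum:
  assumes a: "a \<ge> 0" "b \<ge> 0" and g: "poly_lip 1 (\<lambda>x. g (x 0))"
  shows "E (\<lambda>w. E (\<lambda>v. g (sqrt a *\<^sub>R \<xi> 0 w + sqrt b *\<^sub>R \<xi> 0 v))) = E (\<lambda>w. g (sqrt (a + b) *\<^sub>R \<xi> 0 w))"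
proof -
  obtain Y where Y: "indep_copy H E Y (\<xi> 0)"
    and sum: "\<And>a b. a \<ge> 0 \<Longrightarrow> b \<ge> 0 \<Longrightarrow> eq_dist E (\<lambda>w. a *\<^sub>R \<xi> 0 w + b *\<^sub>R Y w) (\<lambda>w. sqrt (a\<^sup>2 + b\<^sup>2) *\<^sub>R \<xi> 0 w)"
    using G_normal[of 0] by (auto simp: G_normal_def)
  have g1: "poly_lip 1 (\<lambda>x. g (u + c *\<^sub>R x 0))" for u c
    by (rule poly_lip_comp_Lipschitz[OF g, of "\<bar>c\<bar>" "\<lambda>x i. u + c *\<^sub>R x 0"])
      (auto simp: sum_norm_def scaleR_diff_right[symmetric])
  have g2: "poly_lip 2 (\<lambda>x. g (sqrt a *\<^sub>R x 0 + sqrt b *\<^sub>R x 1))"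
  proof (rule poly_lip_comp_Lipschitz[OF g, of "sqrt a + sqrt b" "\<lambda>x i. sqrt a *\<^sub>R x 0 + sqrt b *\<^sub>R x 1"])
    fix x y :: "nat \<Rightarrow> real ^ 'd"
    have "norm (sqrt a *\<^sub>R x 0 + sqrt b *\<^sub>R x 1 - (sqrt a *\<^sub>R y 0 + sqrt b *\<^sub>R y 1)) = norm (sqrt a *\<^sub>R (x 0 - y 0) + sqrt b *\<^sub>R (x 1 - y 1))"
      by (simp add: algebra_simps)
    also have "\<dots> \<le> sqrt a * norm (x 0 - y 0) + sqrt b * norm (x 1 - y 1)"
      by (rule order_trans[OF norm_triangle_ineq]) (simp add: a)
    also have "\<dots> \<le> (sqrt a + sqrt b) * sum_norm 2 (\<lambda>i. x i - y i)"
      by (simp add: sum_norm_def numeral_2_eq_2 algebra_simps a)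
    finally show "sum_norm 1 (\<lambda>i. sqrt a *\<^sub>R x 0 + sqrt b *\<^sub>R x 1 - (sqrt a *\<^sub>R y 0 + sqrt b *\<^sub>R y 1))
      \<le> (sqrt a + sqrt b) * sum_norm 2 (\<lambda>i. x i - y i)" by (simp add: sum_norm_def)
  qed (use a in auto)
  \<comment> \<open>The copy \<open>Y\<close> has the law of \<open>\<xi> 0\<close> and may replace
    the inner variable for each frozen \<open>u\<close>; independence then joins the two
    expectations into one.\<close>
  have "E (\<lambda>v. g (u + sqrt b *\<^sub>R \<xi> 0 v)) = E (\<lambda>v. g (u + sqrt b *\<^sub>R Y v))" for u
    using Y eq_dist_E[OF _ g1[of u "sqrt b"], of E Y "\<xi> 0"] by (simp add: indep_copy_def)
  then have "E (\<lambda>w. E (\<lambda>v. g (sqrt a *\<^sub>R \<xi> 0 w + sqrt b *\<^sub>R \<xi> 0 v))) = E (\<lambda>w. E (\<lambda>v. g (sqrt a *\<^sub>R \<xi> 0 w + sqrt b *\<^sub>R Y v)))"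
    by simp
  also have "\<dots> = E (\<lambda>w. g (sqrt a *\<^sub>R \<xi> 0 w + sqrt b *\<^sub>R Y w))"
    using indep_from_E[of E 1 "\<lambda>w _. Y w" 1 "\<lambda>w _. \<xi> 0 w", OF _ g2[folded one_add_one]] Y
    by (simp add: indep_copy_def tuple_append_def)
  also have "\<dots> = E (\<lambda>w. g (sqrt (a + b) *\<^sub>R \<xi> 0 w))"
    using eq_dist_E[OF sum[of "sqrt a" "sqrt b"] g] a by simp
  finally show ?thesis .
qed

section \<open>Consistency of the iterated expectation\<close>

lemma iter_E_cong:
  "(\<And>i. i < n \<Longrightarrow> a i = b i) \<Longrightarrow> iter_E a n f = iter_E b n f"
  by (induction n arbitrary: f) auto

text \<open>For a point inserted before the partition: the new first coordinate is integrated last,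
  when only a constant is left.\<close>

lemma iter_E_drop_first:
  assumes "poly_lip n f" "\<And>i. i < n \<Longrightarrow> b (Suc i) = a i"
  shows "iter_E b (Suc n) (\<lambda>x. f (\<lambda>i. x (Suc i))) = iter_E a n f"
  using assms
proof (induction n arbitrary: f)
  case 0
  have f: "f x = f (\<lambda>_. 0)" for x by (rule poly_lip_cong_on[OF 0(1)]) simp
  have "iter_E b (Suc 0) (\<lambda>x. f (\<lambda>i. x (Suc i))) = E (\<lambda>w. f (\<lambda>i. ((\<lambda>_. 0)(0 := sqrt (b 0) *\<^sub>R \<xi> 0 w)) (Suc i)))"
    by (simp add: integrate_coord_def)
  also have "\<dots> = E (\<lambda>w. f (\<lambda>_. 0))" by simp
  finally show ?case by (simp add: const)
next
  case (Suc n)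
  have "integrate_coord (b (Suc n)) (Suc n) (\<lambda>x. f (\<lambda>i. x (Suc i))) x = integrate_coord (a n) n f (\<lambda>i. x (Suc i))" for x
    unfolding integrate_coord_def using Suc.prems(2)[of n]
    by (auto intro!: arg_cong[of _ _ E] arg_cong[of _ _ f] ext)
  then have "iter_E b (Suc (Suc n)) (\<lambda>x. f (\<lambda>i. x (Suc i))) = iter_E b (Suc n) (\<lambda>x. integrate_coord (a n) n f (\<lambda>i. x (Suc i)))"
    unfolding iter_E.simps(2)[of b "Suc n"] by presburger
  also have "\<dots> = iter_E a (Suc n) f"
    using Suc.IH[OF poly_lip_integrate_coord[OF Suc.prems(1)]] Suc.prems(2) by simp
  finally show ?case .
qed

text \<open>For a point inserted inside the partition. Integration of coordinates beyond the merged
  pair commutes with merging, so the induction descends until the pair comes last, where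
  \<open>integrate_coord_sum\<close> applies.\<close>

lemma iter_E_merge_coords:
  assumes "j < n" "poly_lip n f" "\<And>i. i < n \<Longrightarrow> merge_coords j b i = a i" "b j \<ge> 0" "b (Suc j) \<ge> 0"
  shows "iter_E b (Suc n) (\<lambda>x. f (merge_coords j x)) = iter_E a n f"
  using assms
proof (induction n arbitrary: f)
  case (Suc n)
  show ?case
  proof (cases "j = n")
    case True
    have g: "poly_lip 1 (\<lambda>z. f (x(n := z 0)))" for x
      using poly_lip_fun_upd_scaleR[OF Suc.prems(2), of x 1] unfolding scaleR_one .
    have "integrate_coord (b n) n (integrate_coord (b (Suc n)) (Suc n) (\<lambda>x. f (merge_coords j x))) x
        = integrate_coord (a n) n f x" for x
    proof -
      have "f (merge_coords j (x(n := u, Suc n := v))) = f (x(n := u + v))" for u v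
        by (rule poly_lip_cong_on[OF Suc.prems(2)]) (auto simp: merge_coords_def True)
      moreover have "b j + b (Suc j) = a n" using Suc.prems(3)[of n] by (simp add: True merge_coords_def)
      ultimately show ?thesis
        using integrate_coord_sum[OF Suc.prems(4,5) g, of x]
        unfolding integrate_coord_def True by (simp only:)
    qed
    then have "iter_E b (Suc (Suc n)) (\<lambda>x. f (merge_coords j x)) = iter_E b n (integrate_coord (a n) n f)"
      unfolding iter_E.simps(2)[of b "Suc n"] iter_E.simps(2)[of b n] by presburger
    also have "\<dots> = iter_E a n (integrate_coord (a n) n f)"
    proof (rule iter_E_cong)
      fix i assume "i < n"
      then show "b i = a i" using Suc.prems(3)[of i] by (simp add: merge_coords_def True)
    qed
    finally show ?thesis by simp
  next
    case False
    with Suc.prems have jn: "j < n" by simp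
    have "merge_coords j (x(Suc n := z)) = (merge_coords j x)(n := z)" for x :: "nat \<Rightarrow> real ^ 'd" and z
      using jn by (auto simp: merge_coords_def)
    moreover have "b (Suc n) = a n" using Suc.prems(3)[of n] jn by (simp add: merge_coords_def)
    ultimately have "integrate_coord (b (Suc n)) (Suc n) (\<lambda>x. f (merge_coords j x)) x = integrate_coord (a n) n f (merge_coords j x)" for x
      unfolding integrate_coord_def by simp
    then have "iter_E b (Suc (Suc n)) (\<lambda>x. f (merge_coords j x)) = iter_E b (Suc n) (\<lambda>x. integrate_coord (a n) n f (merge_coords j x))"
      unfolding iter_E.simps(2)[of b "Suc n"] by presburger
    also have "\<dots> = iter_E a (Suc n) f"
      using Suc.IH[OF jn poly_lip_integrate_coord[OF Suc.prems(2)]] Suc.prems(3-5) by simp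
    finally show ?thesis .
  qed
qed simp

text \<open>No interchange is involved, since later coordinates are integrated first anyway. The
  first conjunct, from the same induction, lets the inner expectation serve as a test function of
  the first \<open>m\<close> coordinates.\<close>

lemma iter_E_tuple_append:
  assumes "poly_lip (m + n) f"
  shows "poly_lip m (\<lambda>x. iter_E (\<lambda>i. a (m + i)) n (\<lambda>y. f (tuple_append m x y)))
    \<and> iter_E a (m + n) f = iter_E a m (\<lambda>x. iter_E (\<lambda>i. a (m + i)) n (\<lambda>y. f (tuple_append m x y)))"
  using assms
proof (induction n arbitrary: f)
  case 0
  then have f: "poly_lip m f" by simp
  have "f (tuple_append m x y) = f x" for x y
    by (rule poly_lip_cong_on[OF f]) (simp add: tuple_append_def)
  with f show ?case by simp
next
  case (Suc n)
  have "poly_lip (m + n) (integrate_coord (a (m + n)) (m + n) f)"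
    using Suc.prems by (intro poly_lip_integrate_coord) simp
  moreover have "iter_E (\<lambda>i. a (m + i)) (Suc n) (\<lambda>y. f (tuple_append m x y))
     = iter_E (\<lambda>i. a (m + i)) n (\<lambda>y. integrate_coord (a (m + n)) (m + n) f (tuple_append m x y))" for x
    by (simp add: integrate_coord_def[abs_def] tuple_append_fun_upd)
  ultimately show ?case using Suc.IH by simp
qed

end

section \<open>The G-expectation on cylinder functions\<close>

lemma B_shift: "B u (shift s \<omega>) = B (u + s) \<omega> - B s \<omega>"
  by (simp add: B_def shift.rep_eq)

lemma shift_0: "shift 0 \<omega> = \<omega>"
  by transfer auto

lemma shift_shift: "shift t (shift s \<omega>) = shift (s + t) \<omega>"
  by transfer (auto simp: algebra_simps)

lemma strict_step_mono:
  fixes t :: "nat \<Rightarrow> real"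
  assumes "\<forall>i<n. t i < t (Suc i)" "i < j" "j \<le> n"
  shows "t i < t j"
  using assms(2,3)
proof (induction j)
  case (Suc j)
  then have "t j < t (Suc j)" using assms(1) by simp
  with Suc show ?case by (cases "i = j") auto
qed simp

text \<open>Both sequences enumerate the sorted list of the same finite set. Hence refinements can
  be compared through their sets of points.\<close>

lemma strict_step_unique:
  fixes t t' :: "nat \<Rightarrow> real"
  assumes t: "\<forall>i<n. t i < t (Suc i)" and t': "\<forall>i<n'. t' i < t' (Suc i)"
    and eq: "t ` {..n} = t' ` {..n'}"
  shows "n = n'" and "\<And>i. i \<le> n \<Longrightarrow> t i = t' i"
proof -
  have srt: "sorted_list_of_set (t ` {..n}) = map t [0..<Suc n]" if "\<forall>i<n. t i < t (Suc i)" for n and t :: "nat \<Rightarrow> real"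
  proof -
    have "sorted_wrt (<) (map t [0..<Suc n])"
      using strict_step_mono[OF that] by (auto simp: sorted_wrt_iff_nth_less simp del: upt_Suc)
    moreover have "set (map t [0..<Suc n]) = t ` {..n}" by (auto simp: atLeast0LessThan lessThan_Suc_atMost simp del: upt_Suc)
    ultimately show ?thesis
      by (metis sorted_list_of_set.idem_if_sorted_distinct strict_sorted_iff)
  qed
  have m: "map t [0..<Suc n] = map t' [0..<Suc n']"
    using srt[OF t] srt[OF t'] eq by simp
  from arg_cong[OF m, of length] show n: "n = n'" by simp
  fix i assume "i \<le> n"
  then show "t i = t' i" using arg_cong[OF m, of "\<lambda>l. l ! i"] n by (simp del: upt_Suc)
qed

text \<open>The path is piecewise linear: \<open>c i\<close> rises from 0 to 1 on the interval
  number \<open>i\<close> and is constant elsewhere.\<close>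

lemma path_with_increments:
  fixes x :: "nat \<Rightarrow> real ^ 'd::finite"
  assumes t: "\<forall>i<n. t i < t (Suc i)"
  obtains \<omega> where "\<And>i. i < n \<Longrightarrow> B (t (Suc i)) \<omega> - B (t i) \<omega> = x i"
proof -
  define c where "c i s = max 0 (min 1 ((s - t i) / (t (Suc i) - t i)))" for i s
  define g where "g s = (\<Sum>i<n. c i s *\<^sub>R x i)" for s
  have cont: "continuous_on UNIV g" unfolding g_def c_def
    by (intro continuous_intros) (use t in auto)
  \<comment> \<open>Subtracting \<open>g 0\<close> makes the path vanish at time 0, wherever 0 lies
    relative to the partition, and leaves the increments unchanged.\<close>
  define \<omega> where "\<omega> = Abs_paths (\<lambda>s. g s - g 0)"
  have B: "B s \<omega> = g s - g 0" for s
    unfolding B_def \<omega>_def by (subst Abs_paths_inverse) (auto intro!: continuous_intros cont)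
  have le: "t i \<le> t k" if "i \<le> k" "k \<le> n" for i k
    using strict_step_mono[OF t, of i k] that by (cases "i = k") auto
  have c: "c i (t (Suc k)) - c i (t k) = (if i = k then 1 else 0)" if "i < n" "k < n" for i k
  proof -
    have pos: "t (Suc i) - t i > 0" using t that by simp
    consider "i < k" | "i = k" | "k < i" by linarith
    then show ?thesis
    proof cases
      case 1
      then have "t (Suc i) \<le> t k" "t (Suc i) \<le> t (Suc k)" using that by (auto intro!: le)
      with pos 1 show ?thesis by (simp add: c_def max_def min_def field_simps)
    next
      case 2
      with pos show ?thesis by (simp add: c_def)
    next
      case 3
      then have "t k \<le> t i" "t (Suc k) \<le> t i" using that by (auto intro!: le)
      with pos 3 have "(t k - t i) / (t (Suc i) - t i) \<le> 0" "(t (Suc k) - t i) / (t (Suc i) - t i) \<le> 0"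
        by (auto intro!: divide_nonpos_pos)
      with 3 show ?thesis by (simp add: c_def)
    qed
  qed
  have "B (t (Suc k)) \<omega> - B (t k) \<omega> = x k" if "k < n" for k
  proof -
    have "B (t (Suc k)) \<omega> - B (t k) \<omega> = (\<Sum>i<n. (c i (t (Suc k)) - c i (t k)) *\<^sub>R x i)"
      unfolding B g_def by (simp add: scaleR_diff_left sum_subtractf)
    also have "\<dots> = (\<Sum>i<n. if i = k then x i else 0)"
      using that by (intro sum.cong) (auto simp: c)
    also have "\<dots> = x k" using that by simp
    finally show ?thesis .
  qed
  then show thesis by (rule that)
qed

lemma cylinder_rep_iff:
  "cylinder_rep n t f X \<longleftrightarrow> n \<ge> 1 \<and> (\<forall>i<n. t i < t (Suc i)) \<and> poly_lip n f \<and>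
     X = (\<lambda>\<omega>. f (\<lambda>i. B (t (Suc i)) \<omega> - B (t i) \<omega>))"
  by (simp add: cylinder_rep_def C_l_lip_iff)

text \<open>Some path attains the increments \<open>x\<close>. This yields monotonicity of the
  G-expectation and, applied in both directions, uniqueness of the test function over a fixed
  partition.\<close>

lemma cylinder_rep_le:
  assumes X: "cylinder_rep n t f X" and Y: "cylinder_rep n t g Y" and le: "\<And>\<omega>. X \<omega> \<le> Y \<omega>"
  shows "f x \<le> g x"
proof -
  from X have t: "\<forall>i<n. t i < t (Suc i)" by (simp add: cylinder_rep_iff)
  obtain \<omega> where \<omega>: "\<And>i. i < n \<Longrightarrow> B (t (Suc i)) \<omega> - B (t i) \<omega> = x i"
    using path_with_increments[OF t] by blast
  have "h x = Z \<omega>" if "cylinder_rep n t h Z" for h Z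
  proof -
    have "h x = h (\<lambda>i. B (t (Suc i)) \<omega> - B (t i) \<omega>)"
      by (rule poly_lip_cong_on[of n]) (use that \<omega> in \<open>simp_all add: cylinder_rep_iff\<close>)
    with that show ?thesis by (simp add: cylinder_rep_iff)
  qed
  from this[OF X] this[OF Y] le show ?thesis by simp
qed

lemma cylinder_rep_cong:
  assumes "cylinder_rep n t f X" "\<And>i. i \<le> n \<Longrightarrow> t i = t' i"
  shows "cylinder_rep n t' f X"
proof -
  have "f (\<lambda>i. B (t (Suc i)) \<omega> - B (t i) \<omega>) = f (\<lambda>i. B (t' (Suc i)) \<omega> - B (t' i) \<omega>)" for \<omega>
    by (rule poly_lip_cong_on[of n]) (use assms in \<open>auto simp: cylinder_rep_iff\<close>)
  with assms show ?thesis by (auto simp: cylinder_rep_iff)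
qed

lemma cylinder_rep_shift:
  "cylinder_rep n t f X \<Longrightarrow> cylinder_rep n (\<lambda>i. t i + s) f (X \<circ> shift s)"
  by (auto simp: cylinder_rep_iff B_shift)

lemma poly_lip_drop_first:
  "poly_lip n f \<Longrightarrow> poly_lip (Suc n) (\<lambda>x. f (\<lambda>i. x (Suc i)))"
  by (rule poly_lip_comp_Lipschitz[where K = 1 and n = n and f = f])
    (simp_all add: sum_norm_def sum.lessThan_Suc_shift del: sum.lessThan_Suc)

lemma poly_lip_mono:
  assumes "poly_lip m f" "m \<le> n" shows "poly_lip n f"
  by (rule poly_lip_comp_Lipschitz[OF assms(1), of 1 "\<lambda>x. x"]) (simp_all add: sum_norm_mono assms(2))

lemma poly_lip_merge_coords:
  assumes f: "poly_lip n f" and j: "j < n"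
  shows "poly_lip (Suc n) (\<lambda>x. f (merge_coords j x))"
\<comment> \<open>Bounding entry \<open>i\<close> of the merged tuple by the differences at
  \<open>i\<close> and \<open>Suc i\<close> counts each difference at most twice.\<close>
proof (rule poly_lip_comp_Lipschitz[OF f, of 2])
  fix x y :: "nat \<Rightarrow> 'a"
  let ?d = "\<lambda>i. norm (x i - y i)"
  have "norm (merge_coords j x i - merge_coords j y i) \<le> ?d i + ?d (Suc i)" for i
    using norm_triangle_ineq[of "x j - y j" "x (Suc j) - y (Suc j)"]
    by (auto simp: merge_coords_def algebra_simps)
  then have "sum_norm n (\<lambda>i. merge_coords j x i - merge_coords j y i) \<le> (\<Sum>i<n. ?d i + ?d (Suc i))"
    unfolding sum_norm_def by (intro sum_mono) auto
  also have "\<dots> \<le> sum ?d {..<Suc n} + sum ?d {..<Suc n}"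
    unfolding sum.distrib
    by (intro add_mono) (simp, subst sum.lessThan_Suc_shift, simp)
  finally show "sum_norm n (\<lambda>i. merge_coords j x i - merge_coords j y i) \<le> 2 * sum_norm (Suc n) (\<lambda>i. x i - y i)"
    unfolding sum_norm_def by linarith
qed simp

section \<open>Independence of the representation\<close>

context G_normal_sequence
begin

text \<open>For a point added after the partition: the new coordinate is integrated first, against a
  function that ignores it.\<close>

lemma iter_E_extra_coord:
  assumes "poly_lip n f" shows "iter_E a (Suc n) f = iter_E a n f"
proof -
  have "f (x(n := z)) = f x" for x z by (rule poly_lip_cong_on[OF assms]) simp
  then show ?thesis by (simp add: integrate_coord_def[abs_def] const)
qed

definition cylinder_E :: "nat \<Rightarrow> (nat \<Rightarrow> real) \<Rightarrow> ((nat \<Rightarrow> real ^ 'd) \<Rightarrow> real) \<Rightarrow> real" where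
  "cylinder_E n t f = iter_E (\<lambda>i. t (Suc i) - t i) n f"

text \<open>The point lies before, after or strictly inside the partition, matching the three
  consistency lemmas. The set of points is recorded so that insertions can be iterated.\<close>

lemma cylinder_rep_insert:
  assumes X: "cylinder_rep n t f X" and r: "r \<notin> t ` {..n}"
  shows "\<exists>t' f'. cylinder_rep (Suc n) t' f' X \<and> t' ` {..Suc n} = insert r (t ` {..n})
    \<and> cylinder_E (Suc n) t' f' = cylinder_E n t f"
proof -
  from X have n: "n \<ge> 1" and t: "\<forall>i<n. t i < t (Suc i)" and f: "poly_lip n f"
    and Xf: "X = (\<lambda>\<omega>. f (\<lambda>i. B (t (Suc i)) \<omega> - B (t i) \<omega>))"
    by (auto simp: cylinder_rep_iff)
  from r have rt: "r \<noteq> t i" if "i \<le> n" for i using that by auto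
  consider "r < t 0" | "r > t n" | "t 0 \<le> r" "r \<le> t n" by linarith
  then show ?thesis
  proof cases
    case 1
    define t' where "t' = case_nat r t"
    have "t' ` {..Suc n} = insert r (t ` {..n})"
      by (simp add: atMost_Suc_eq_insert_0 image_image t'_def)
    moreover have "cylinder_rep (Suc n) t' (\<lambda>x. f (\<lambda>i. x (Suc i))) X"
      using 1 t poly_lip_drop_first[OF f] unfolding cylinder_rep_iff Xf
      by (auto simp: t'_def split: nat.split)
    moreover have "cylinder_E (Suc n) t' (\<lambda>x. f (\<lambda>i. x (Suc i))) = cylinder_E n t f"
      unfolding cylinder_E_def by (rule iter_E_drop_first[OF f]) (simp add: t'_def)
    ultimately show ?thesis by blast
  next
    case 2
    define t' where "t' i = (if i \<le> n then t i else r)" for i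
    have "t' ` {..Suc n} = insert r (t ` {..n})"
      by (auto simp: atMost_Suc t'_def image_iff)
    moreover have "cylinder_rep n t' f X"
      by (rule cylinder_rep_cong[OF X]) (simp add: t'_def)
    then have "cylinder_rep (Suc n) t' f X"
      using 2 poly_lip_mono[OF f, of "Suc n"] by (auto simp: cylinder_rep_iff t'_def less_Suc_eq)
    moreover have "cylinder_E (Suc n) t' f = cylinder_E n t f"
      unfolding cylinder_E_def iter_E_extra_coord[OF f] by (rule iter_E_cong) (simp add: t'_def)
    ultimately show ?thesis by blast
  next
    case 3
    \<comment> \<open>The interval that contains \<open>r\<close> starts at
      \<open>t j\<close>.\<close>
    define j where "j = Max {i. i \<le> n \<and> t i \<le> r}"
    have "j \<in> {i. i \<le> n \<and> t i \<le> r}" unfolding j_def by (rule Max_in) (use 3 in auto)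
    then have j: "j \<le> n" "t j \<le> r" by auto
    with rt[of j] have j1: "t j < r" by simp
    with rt[of n] j 3(2) have "j \<noteq> n" by auto
    with j j1 have j1: "j < n" "t j < r" by simp_all
    have j2: "r < t (Suc j)"
    proof (rule ccontr)
      assume "\<not> r < t (Suc j)"
      then have "Suc j \<in> {i. i \<le> n \<and> t i \<le> r}" using j1 by simp
      then have "Suc j \<le> j" unfolding j_def by (intro Max_ge) auto
      then show False by simp
    qed
    define t' where "t' i = (if i \<le> j then t i else if i = Suc j then r else t (i - 1))" for i
    have "t' ` {..Suc n} = insert r (t ` {..n})"
    proof
      show "t' ` {..Suc n} \<subseteq> insert r (t ` {..n})" using j1 by (auto simp: t'_def)
      show "insert r (t ` {..n}) \<subseteq> t' ` {..Suc n}"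
      proof
        fix s assume "s \<in> insert r (t ` {..n})"
        then consider "s = r" | i where "i \<le> n" "s = t i" by auto
        then show "s \<in> t' ` {..Suc n}"
        proof cases
          case 1
          then show ?thesis using j1 by (intro image_eqI[of _ _ "Suc j"]) (auto simp: t'_def)
        next
          case 2
          then show ?thesis
            by (intro image_eqI[of _ _ "if i \<le> j then i else Suc i"]) (auto simp: t'_def)
        qed
      qed
    qed
    moreover have "cylinder_rep (Suc n) t' (\<lambda>x. f (merge_coords j x)) X"
      unfolding cylinder_rep_iff
    proof (intro conjI allI impI ext)
      fix i assume i: "i < Suc n"
      consider "i < j" | "i = j" | "i = Suc j" | "i > Suc j" by linarith
      then show "t' i < t' (Suc i)"
      proof cases
        case 4
        then obtain k where k: "i = Suc k" "k > j" by (cases i) auto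
        then have "t k < t (Suc k)" using t i by simp
        with k show ?thesis by (simp add: t'_def)
      qed (use t j1 j2 i in \<open>auto simp: t'_def\<close>)
    next
      fix \<omega>
      show "X \<omega> = f (merge_coords j (\<lambda>i. B (t' (Suc i)) \<omega> - B (t' i) \<omega>))"
        unfolding Xf by (rule arg_cong[of _ _ f]) (auto simp: merge_coords_def t'_def)
    qed (use poly_lip_merge_coords[OF f j1(1)] in auto)
    moreover have "cylinder_E (Suc n) t' (\<lambda>x. f (merge_coords j x)) = cylinder_E n t f"
      unfolding cylinder_E_def
      by (rule iter_E_merge_coords[OF j1(1) f]) (use j1 j2 in \<open>auto simp: merge_coords_def t'_def\<close>)
    ultimately show ?thesis by blast
  qed
qed

lemma cylinder_rep_refine:
  assumes "finite P" "cylinder_rep n t f X"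
  shows "\<exists>n' t' f'. cylinder_rep n' t' f' X \<and> t' ` {..n'} = P \<union> t ` {..n}
    \<and> cylinder_E n' t' f' = cylinder_E n t f"
  using assms(1)
proof induction
  case empty
  then show ?case using assms(2) by auto
next
  case (insert r P)
  then obtain n' t' f' where *: "cylinder_rep n' t' f' X" "t' ` {..n'} = P \<union> t ` {..n}"
    "cylinder_E n' t' f' = cylinder_E n t f" by blast
  show ?case
  proof (cases "r \<in> t' ` {..n'}")
    case True
    with * show ?thesis by (metis Un_insert_left insert_absorb)
  next
    case False
    from cylinder_rep_insert[OF *(1) False] * show ?thesis by (metis Un_insert_left)
  qed
qed

text \<open>Refining both representations to the union of their points changes neither value; on the
  common partition the test functions coincide because every tuple of increments is
  attained.\<close>

lemma cylinder_E_unique: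
  assumes X: "cylinder_rep n t f X" and X': "cylinder_rep n' t' f' X"
  shows "cylinder_E n t f = cylinder_E n' t' f'"
proof -
  obtain m s g where 1: "cylinder_rep m s g X" "s ` {..m} = t' ` {..n'} \<union> t ` {..n}"
    "cylinder_E m s g = cylinder_E n t f" 
    using cylinder_rep_refine[OF finite_imageI[OF finite_atMost] X, of t' n'] by blast
  obtain m' s' g' where 2: "cylinder_rep m' s' g' X" "s' ` {..m'} = t ` {..n} \<union> t' ` {..n'}"
    "cylinder_E m' s' g' = cylinder_E n' t' f'" 
    using cylinder_rep_refine[OF finite_imageI[OF finite_atMost] X', of t n] by blast
  have eq: "s ` {..m} = s' ` {..m'}" unfolding 1(2) 2(2) by (rule Un_commute)
  from 1(1) 2(1) have st: "\<forall>i<m. s i < s (Suc i)" "\<forall>i<m'. s' i < s' (Suc i)"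
    by (simp_all add: cylinder_rep_iff)
  note u = strict_step_unique[OF st eq]
  have g': "cylinder_rep m s g' X" using cylinder_rep_cong[OF 2(1), of s] u by simp
  have "g x = g' x" for x
    using cylinder_rep_le[OF 1(1) g' order_refl] cylinder_rep_le[OF g' 1(1) order_refl] by (rule order_antisym)
  then have "g = g'" by blast
  then have "cylinder_E m s g = cylinder_E m' s' g'"
    unfolding cylinder_E_def u(1)[symmetric] \<open>g = g'\<close> by (intro iter_E_cong) (simp add: u(2))
  then show ?thesis unfolding 1(3) 2(3) .
qed

abbreviation GE where "GE \<equiv> G_expectation E \<xi>"

lemma GE_eq_cylinder_E:
  assumes "cylinder_rep n t f X" shows "GE X = cylinder_E n t f"
proof -
  have *: "E (\<lambda>w. f (\<lambda>i. sqrt (t (Suc i) - t i) *\<^sub>R \<xi> i w)) = cylinder_E n t f"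
    if "cylinder_rep n t f X" for n t f
    unfolding cylinder_E_def by (rule E_eq_iter_E) (use that in \<open>simp add: cylinder_rep_iff\<close>)
  show ?thesis unfolding G_expectation_def
  proof (rule the_equality)
    show "\<exists>n' t' f'. cylinder_rep n' t' f' X \<and>
        cylinder_E n t f = E (\<lambda>w. f' (\<lambda>i. sqrt (t' (Suc i) - t' i) *\<^sub>R \<xi> i w))"
      using assms *[OF assms, symmetric] by blast
  next
    fix v assume "\<exists>n t f. cylinder_rep n t f X \<and> v = E (\<lambda>w. f (\<lambda>i. sqrt (t (Suc i) - t i) *\<^sub>R \<xi> i w))"
    then obtain n' t' f' where X: "cylinder_rep n' t' f' X"
      and v: "v = E (\<lambda>w. f' (\<lambda>i. sqrt (t' (Suc i) - t' i) *\<^sub>R \<xi> i w))" by blast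
    show "v = cylinder_E n t f" unfolding v *[OF X] by (rule cylinder_E_unique[OF X assms])
  qed
qed

lemma GE_eq_E:
  assumes "cylinder_rep n t f X"
  shows "GE X = E (\<lambda>w. f (\<lambda>i. sqrt (t (Suc i) - t i) *\<^sub>R \<xi> i w))"
  using GE_eq_cylinder_E[OF assms] E_eq_iter_E[of n f] assms
  by (simp add: cylinder_E_def cylinder_rep_iff)

lemma cylinder_fun_mem:
  "poly_lip n f \<Longrightarrow> (\<lambda>w. f (\<lambda>i. sqrt (a i) *\<^sub>R \<xi> i w)) \<in> H"
  by (rule poly_lip_random_vectors_mem) (auto intro: random_vector_scaleR rv_xi)

text \<open>All partition points move by \<open>s\<close>; the value involves them only through the
  lengths of the intervals.\<close>

lemma GE_shift: "X \<in> Lip_Omega \<Longrightarrow> GE (X \<circ> shift s) = GE X"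
proof -
  assume "X \<in> Lip_Omega"
  then obtain n t f where *: "cylinder_rep n t f X" by (auto simp: Lip_Omega_def)
  show ?thesis
    unfolding GE_eq_cylinder_E[OF *] GE_eq_cylinder_E[OF cylinder_rep_shift[OF *]]
    by (simp add: cylinder_E_def)
qed

section \<open>Cylinder functions as a sublinear expectation space\<close>

lemma common_partition:
  fixes Z :: "nat \<Rightarrow> 'd paths \<Rightarrow> real"
  assumes "k > 0" "\<And>i. i < k \<Longrightarrow> Z i \<in> Lip_Omega"
  obtains n t g where "\<And>i. i < (k::nat) \<Longrightarrow> cylinder_rep n t (g i) (Z i)"
proof -
  from assms(2) have "\<forall>i. \<exists>n t f. i < k \<longrightarrow> cylinder_rep n t f (Z i)" by (auto simp: Lip_Omega_def)
  then obtain N T F where rep: "\<And>i. i < k \<Longrightarrow> cylinder_rep (N i) (T i) (F i) (Z i)" by metis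
  define P where "P = (\<Union>i<k. T i ` {..N i})"
  have P: "finite P" by (simp add: P_def)
  have "\<forall>i. \<exists>n t f. i < k \<longrightarrow> cylinder_rep n t f (Z i) \<and> t ` {..n} = P"
  proof (intro allI)
    fix i
    show "\<exists>n t f. i < k \<longrightarrow> cylinder_rep n t f (Z i) \<and> t ` {..n} = P"
    proof (cases "i < k")
      case True
      then have "P \<union> T i ` {..N i} = P" by (auto simp: P_def)
      with cylinder_rep_refine[OF P rep[OF True]] show ?thesis by auto
    qed simp
  qed
  then obtain N' T' F' where rep': "\<And>i. i < k \<Longrightarrow> cylinder_rep (N' i) (T' i) (F' i) (Z i)"
    and im: "\<And>i. i < k \<Longrightarrow> T' i ` {..N' i} = P" by metis
  \<comment> \<open>The refinements share the point set \<open>P\<close>, hence are the same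
    partition; that of \<open>Z 0\<close>, present as \<open>k > 0\<close>, represents it.\<close>
  have "cylinder_rep (N' 0) (T' 0) (F' i) (Z i)" if "i < k" for i
  proof -
    have "\<forall>l<N' i. T' i l < T' i (Suc l)" "\<forall>l<N' 0. T' 0 l < T' 0 (Suc l)"
      using rep'[OF that] rep'[OF assms(1)] by (auto simp: cylinder_rep_iff)
    note u = strict_step_unique[OF this, unfolded im[OF that] im[OF assms(1)], OF refl]
    show ?thesis using cylinder_rep_cong[OF rep'[OF that], of "T' 0"] u by simp
  qed
  then show thesis by (rule that)
qed

lemma common_partition2:
  fixes X Y :: "'d paths \<Rightarrow> real"
  assumes "X \<in> Lip_Omega" "Y \<in> Lip_Omega"
  obtains n t f g where "cylinder_rep n t f X" "cylinder_rep n t g Y"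
proof -
  obtain n t g where "\<And>i. i < (2::nat) \<Longrightarrow> cylinder_rep n t (g i) (if i = 0 then X else Y)"
    by (rule common_partition[of 2 "\<lambda>i. if i = 0 then X else Y"]) (use assms in auto)
  from this[of 0] this[of 1] show thesis by (intro that) auto
qed

text \<open>A representation has at least one interval; the embedding of the naturals supplies
  \<open>0 < 1\<close>.\<close>

lemma cylinder_rep_const: "cylinder_rep 1 real (\<lambda>_. c) (\<lambda>_. c)"
  by (auto simp: cylinder_rep_iff poly_lip_const)

lemma const_mem_Lip_Omega: "(\<lambda>_. c) \<in> Lip_Omega"
  unfolding Lip_Omega_def mem_Collect_eq by (intro exI) (rule cylinder_rep_const)

lemma cylinder_rep_comp:
  assumes "k > 0" "poly_lip k \<phi>" "\<And>i. i < k \<Longrightarrow> cylinder_rep n t (g i) (Z i)"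
  shows "cylinder_rep n t (\<lambda>x. \<phi> (\<lambda>i. g i x)) (\<lambda>\<omega>. \<phi> (\<lambda>i. Z i \<omega>))"
proof -
  have "\<phi> (\<lambda>i. Z i \<omega>) = \<phi> (\<lambda>i. g i (\<lambda>i. B (t (Suc i)) \<omega> - B (t i) \<omega>))" for \<omega>
    by (rule poly_lip_cong_on[OF assms(2)]) (use assms(3) in \<open>simp add: cylinder_rep_iff\<close>)
  moreover have "poly_lip n (\<lambda>x. \<phi> (\<lambda>i. g i x))"
    by (rule poly_lip_comp[OF assms(2)]) (use assms(3) in \<open>simp add: cylinder_rep_iff\<close>)
  ultimately show ?thesis using assms(3)[OF assms(1)] by (simp add: cylinder_rep_iff)
qed

sublocale G: sublinear_expectation Lip_Omega GE
proof
  fix c show "(\<lambda>_. c) \<in> Lip_Omega" by (rule const_mem_Lip_Omega)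
next
  fix X Y :: "'d paths \<Rightarrow> real" assume "X \<in> Lip_Omega" "Y \<in> Lip_Omega"
  then obtain n t f g where *: "cylinder_rep n t f X" "cylinder_rep n t g Y" by (rule common_partition2)
  then have add: "cylinder_rep n t (\<lambda>x. f x + g x) (\<lambda>\<omega>. X \<omega> + Y \<omega>)"
    by (auto simp: cylinder_rep_iff poly_lip_add)
  then show "(\<lambda>\<omega>. X \<omega> + Y \<omega>) \<in> Lip_Omega" by (auto simp: Lip_Omega_def)
  show "GE (\<lambda>\<omega>. X \<omega> + Y \<omega>) \<le> GE X + GE Y"
    unfolding GE_eq_E[OF add] GE_eq_E[OF *(1)] GE_eq_E[OF *(2)]
    by (intro subadd cylinder_fun_mem) (use * in \<open>auto simp: cylinder_rep_iff\<close>)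
next
  fix X Y :: "'d paths \<Rightarrow> real" assume "X \<in> Lip_Omega" "Y \<in> Lip_Omega" and le: "\<And>\<omega>. X \<omega> \<le> Y \<omega>"
  then obtain n t f g where *: "cylinder_rep n t f X" "cylinder_rep n t g Y" using common_partition2 by blast
  show "GE X \<le> GE Y"
    unfolding GE_eq_E[OF *(1)] GE_eq_E[OF *(2)]
    by (intro mono cylinder_fun_mem cylinder_rep_le[OF * le]) (use * in \<open>auto simp: cylinder_rep_iff\<close>)
next
  fix X :: "'d paths \<Rightarrow> real" and c :: real assume "X \<in> Lip_Omega"
  then obtain n t f where *: "cylinder_rep n t f X" by (auto simp: Lip_Omega_def)
  then have sc: "cylinder_rep n t (\<lambda>x. c * f x) (\<lambda>\<omega>. c * X \<omega>)"
    by (auto simp: cylinder_rep_iff poly_lip_mult poly_lip_const)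
  then show "(\<lambda>\<omega>. c * X \<omega>) \<in> Lip_Omega" by (auto simp: Lip_Omega_def)
  show "GE (\<lambda>\<omega>. c * X \<omega>) = c * GE X" if "c \<ge> 0"
    unfolding GE_eq_E[OF sc] GE_eq_E[OF *]
    by (intro pos_hom cylinder_fun_mem that) (use * in \<open>auto simp: cylinder_rep_iff\<close>)
  from * have "cylinder_rep n t (\<lambda>x. \<bar>f x\<bar>) (\<lambda>\<omega>. \<bar>X \<omega>\<bar>)"
    by (auto simp: cylinder_rep_iff poly_lip_abs)
  then show "(\<lambda>\<omega>. \<bar>X \<omega>\<bar>) \<in> Lip_Omega" by (auto simp: Lip_Omega_def)
next
  fix \<phi> :: "(nat \<Rightarrow> real) \<Rightarrow> real" and k :: nat and Z :: "nat \<Rightarrow> 'd paths \<Rightarrow> real"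
  assume phi: "\<phi> \<in> C_l_lip k" and Z: "\<And>i. i < k \<Longrightarrow> Z i \<in> Lip_Omega"
  show "(\<lambda>\<omega>. \<phi> (\<lambda>i. Z i \<omega>)) \<in> Lip_Omega"
  proof (cases "k = 0")
    \<comment> \<open>An empty family provides no partition, but the composition is then a
      constant.\<close>
    case True
    have "\<phi> (\<lambda>i. Z i \<omega>) = \<phi> (\<lambda>_. 0)" for \<omega>
      by (rule poly_lip_cong_on[OF phi[unfolded C_l_lip_iff]]) (simp add: True)
    then show ?thesis by (simp add: const_mem_Lip_Omega)
  next
    case False
    then obtain n t g where g: "\<And>i. i < k \<Longrightarrow> cylinder_rep n t (g i) (Z i)"
      using common_partition[of k Z] Z by auto
    have "cylinder_rep n t (\<lambda>x. \<phi> (\<lambda>i. g i x)) (\<lambda>\<omega>. \<phi> (\<lambda>i. Z i \<omega>))"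
      by (rule cylinder_rep_comp[OF _ _ g]) (use False phi in \<open>simp_all add: C_l_lip_iff\<close>)
    then show ?thesis unfolding Lip_Omega_def by blast
  qed
next
  fix c show "GE (\<lambda>_. c) = c" unfolding GE_eq_E[OF cylinder_rep_const] by (rule const)
qed

lemma Lip_Omega_shift: "X \<in> Lip_Omega \<Longrightarrow> X \<circ> shift s \<in> Lip_Omega"
  unfolding Lip_Omega_def mem_Collect_eq by (blast intro: cylinder_rep_shift)

text \<open>After a large shift, \<open>Y \<circ> shift s\<close> is independent from \<open>Y\<close>, so that
  \<open>GE \<bar>Y - Y \<circ> shift s\<bar>\<close> averages the deviations \<open>GE \<bar>Y - c\<bar>\<close> over the values \<open>c\<close> of \<open>Y\<close>.\<close>

lemma shift_deviation:
  assumes "Y \<in> Lip_Omega"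
  obtains S where "\<And>s b. s \<ge> S \<Longrightarrow> (\<And>c. b \<le> GE (\<lambda>\<omega>. \<bar>Y \<omega> - c\<bar>)) \<Longrightarrow> b \<le> GE (\<lambda>\<omega>. \<bar>Y \<omega> - Y (shift s \<omega>)\<bar>)"
proof -
  from assms obtain n t f where Y: "cylinder_rep n t f Y" by (auto simp: Lip_Omega_def)
  then have t: "\<forall>i<n. t i < t (Suc i)" and f: "poly_lip n f"
    and Yf: "Y = (\<lambda>\<omega>. f (\<lambda>i. B (t (Suc i)) \<omega> - B (t i) \<omega>))"
    by (auto simp: cylinder_rep_iff)
  show thesis
  proof (rule that)
    \<comment> \<open>This threshold puts the start \<open>t 0 + s\<close> of the shifted block
      strictly after \<open>t n\<close>.\<close>
    fix s b assume s: "s \<ge> t n - t 0 + 1" and b: "\<And>c. b \<le> GE (\<lambda>\<omega>. \<bar>Y \<omega> - c\<bar>)"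
    \<comment> \<open>The gap between the two blocks is itself an interval, number \<open>n\<close>;
      hence the shifted increments begin at index \<open>Suc n\<close>.\<close>
    define u where "u i = (if i \<le> n then t i else t (i - Suc n) + s)" for i
    define a where "a i = u (Suc i) - u i" for i
    define F where "F x = \<bar>f x - f (\<lambda>i. x (Suc n + i))\<bar>" for x
    have F: "poly_lip (Suc n + n) F" unfolding F_def
    proof (intro poly_lip_abs poly_lip_diff)
      show "poly_lip (Suc n + n) f" by (rule poly_lip_mono[OF f]) simp
      show "poly_lip (Suc n + n) (\<lambda>x. f (\<lambda>i. x (Suc n + i)))"
      proof (rule poly_lip_comp_Lipschitz[OF f, of 1])
        fix x y :: "nat \<Rightarrow> real ^ 'd"
        have "sum_norm n (\<lambda>i. x (Suc n + i) - y (Suc n + i)) = (\<Sum>i\<in>(+) (Suc n) ` {..<n}. norm (x i - y i))"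
          unfolding sum_norm_def by (subst sum.reindex) auto
        also have "\<dots> \<le> sum_norm (Suc n + n) (\<lambda>i. x i - y i)"
          unfolding sum_norm_def by (intro sum_mono2) auto
        finally show "sum_norm n (\<lambda>i. x (Suc n + i) - y (Suc n + i)) \<le> 1 * sum_norm (Suc n + n) (\<lambda>i. x i - y i)"
          by simp
      qed simp
    qed
    have "cylinder_rep (Suc n + n) u F (\<lambda>\<omega>. \<bar>Y \<omega> - Y (shift s \<omega>)\<bar>)"
      unfolding cylinder_rep_iff
    proof (intro conjI allI impI ext F)
      fix i assume i: "i < Suc n + n"
      consider "i < n" | "i = n" | "i > n" by linarith
      then show "u i < u (Suc i)"
      proof cases
        case 3
        then have "t (i - Suc n) < t (Suc (i - Suc n))" using t i by auto
        moreover have "Suc (i - Suc n) = i - n" using 3 by simp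
        ultimately show ?thesis using 3 by (auto simp: u_def)
      qed (use t s in \<open>auto simp: u_def\<close>)
    next
      fix \<omega>
      have "Y \<omega> = f (\<lambda>i. B (u (Suc i)) \<omega> - B (u i) \<omega>)"
        unfolding Yf by (rule poly_lip_cong_on[OF f]) (simp add: u_def)
      moreover have "Y (shift s \<omega>) = f (\<lambda>i. B (u (Suc (Suc n + i))) \<omega> - B (u (Suc n + i)) \<omega>)"
        unfolding Yf by (rule poly_lip_cong_on[OF f]) (simp add: u_def B_shift)
      ultimately show "\<bar>Y \<omega> - Y (shift s \<omega>)\<bar> = F (\<lambda>i. B (u (Suc i)) \<omega> - B (u i) \<omega>)"
        by (simp add: F_def)
    qed simp
    from GE_eq_cylinder_E[OF this] have GEF: "GE (\<lambda>\<omega>. \<bar>Y \<omega> - Y (shift s \<omega>)\<bar>) = iter_E a (Suc n + n) F"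
      unfolding cylinder_E_def a_def .
    \<comment> \<open>The inner expectation runs over the shifted block. With the earlier increments
      frozen at \<open>x\<close>, the constant subtracted from \<open>Y\<close> is
      \<open>f x\<close>, so \<open>b\<close> bounds \<open>h x\<close>.\<close>
    define h where "h x = iter_E (\<lambda>i. a (Suc n + i)) n (\<lambda>y. F (tuple_append (Suc n) x y))" for x
    have h: "poly_lip (Suc n) h" "iter_E a (Suc n + n) F = iter_E a (Suc n) h"
      using iter_E_tuple_append[OF F, of a] by (simp_all add: h_def[abs_def])
    have hb: "b \<le> h x" for x
    proof -
      have Fx: "F (tuple_append (Suc n) x y) = \<bar>f y - f x\<bar>" for y
      proof -
        have "f (tuple_append (Suc n) x y) = f x"
          by (rule poly_lip_cong_on[OF f]) (simp add: tuple_append_def)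
        then show ?thesis by (simp add: F_def tuple_append_def abs_minus_commute)
      qed
      have "cylinder_rep n t (\<lambda>y. \<bar>f y - f x\<bar>) (\<lambda>\<omega>. \<bar>Y \<omega> - f x\<bar>)"
        using Y by (auto simp: cylinder_rep_iff intro!: poly_lip_abs poly_lip_diff poly_lip_const)
      then have "GE (\<lambda>\<omega>. \<bar>Y \<omega> - f x\<bar>) = cylinder_E n t (\<lambda>y. \<bar>f y - f x\<bar>)"
        by (rule GE_eq_cylinder_E)
      also have "\<dots> = h x"
        unfolding h_def Fx cylinder_E_def by (rule iter_E_cong) (simp add: a_def u_def)
      finally show ?thesis using b[of "f x"] by simp
    qed
    have "b = E (\<lambda>_. b)" by (simp add: const)
    also have "\<dots> \<le> E (\<lambda>w. h (\<lambda>i. sqrt (a i) *\<^sub>R \<xi> i w))"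
      by (intro mono const_mem cylinder_fun_mem[OF h(1)] hb)
    also have "\<dots> = GE (\<lambda>\<omega>. \<bar>Y \<omega> - Y (shift s \<omega>)\<bar>)"
      unfolding GEF h(2) by (rule E_eq_iter_E[OF h(1)])
    finally show "b \<le> GE (\<lambda>\<omega>. \<bar>Y \<omega> - Y (shift s \<omega>)\<bar>)" .
  qed
qed

end

section \<open>The completion under the L2 seminorm\<close>

context sublinear_expectation
begin

lemma Lp_norm_2: "X \<in> H \<Longrightarrow> Lp_norm E 2 X = sqrt (E (\<lambda>w. (X w)\<^sup>2))"
proof -
  assume X: "X \<in> H"
  have "(\<lambda>w. \<bar>X w\<bar> powr 2) = (\<lambda>w. (X w)\<^sup>2)" by (simp add: powr_numeral)
  then show ?thesis
    by (simp add: Lp_norm_def powr_half_sqrt E_nonneg square_mem X)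
qed

lemma Lp_norm_nonneg: "0 \<le> Lp_norm E p X"
  by (simp add: Lp_norm_def)

lemma Lp_norm_2_less_iff: "X \<in> H \<Longrightarrow> e > 0 \<Longrightarrow> Lp_norm E 2 X < e \<longleftrightarrow> E (\<lambda>w. (X w)\<^sup>2) < e\<^sup>2"
  by (simp add: Lp_norm_2 real_sqrt_less_iff[of _ "e\<^sup>2", symmetric] del: real_sqrt_less_iff)

text \<open>A triangle inequality without Minkowski: the square of a sum is at most twice the sum of
  the squares, and with radii \<open>e / 2\<close> this gives exactly
  \<open>e\<^sup>2\<close>.\<close>

lemma Lp_norm_2_less_I:
  assumes XYZ: "X \<in> H" "Y \<in> H" "Z \<in> H" and e: "Lp_norm E 2 X < e / 2" "Lp_norm E 2 Y < e / 2"
    and le: "\<And>w. \<bar>Z w\<bar> \<le> \<bar>X w\<bar> + \<bar>Y w\<bar>"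
  shows "Lp_norm E 2 Z < e"
proof -
  have e0: "e > 0" using e(1) Lp_norm_nonneg[of 2 X] by linarith
  have "(Z w)\<^sup>2 \<le> 2 * (X w)\<^sup>2 + 2 * (Y w)\<^sup>2" for w
  proof -
    have "(Z w)\<^sup>2 \<le> (\<bar>X w\<bar> + \<bar>Y w\<bar>)\<^sup>2" using le[of w] by (metis abs_ge_zero power2_abs power_mono)
    also have "\<dots> \<le> 2 * (X w)\<^sup>2 + 2 * (Y w)\<^sup>2"
      using zero_le_power2[of "\<bar>X w\<bar> - \<bar>Y w\<bar>"] by (simp add: power2_sum power2_diff)
    finally show ?thesis .
  qed
  then have "E (\<lambda>w. (Z w)\<^sup>2) \<le> E (\<lambda>w. 2 * (X w)\<^sup>2 + 2 * (Y w)\<^sup>2)"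
    by (intro mono add_mem scale_mem square_mem XYZ)
  also have "\<dots> \<le> 2 * E (\<lambda>w. (X w)\<^sup>2) + 2 * E (\<lambda>w. (Y w)\<^sup>2)"
    by (rule order_trans[OF subadd]) (simp_all add: scale_mem square_mem XYZ pos_hom)
  also have "\<dots> < 2 * (e / 2)\<^sup>2 + 2 * (e / 2)\<^sup>2"
    using e e0 by (intro add_strict_mono mult_strict_left_mono) (simp_all add: Lp_norm_2_less_iff[symmetric] XYZ)
  also have "\<dots> = e\<^sup>2" by (simp add: power2_eq_square)
  finally show ?thesis using e0 by (simp add: Lp_norm_2_less_iff XYZ)
qed

lemma Lp_norm_2_le:
  assumes "X \<in> H" "Y \<in> H" "\<And>w. \<bar>X w\<bar> \<le> \<bar>Y w\<bar>"
  shows "Lp_norm E 2 X \<le> Lp_norm E 2 Y"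
  unfolding Lp_norm_2[OF assms(1)] Lp_norm_2[OF assms(2)]
  by (intro real_sqrt_le_mono mono square_mem assms) (simp add: abs_le_square_iff[symmetric] assms)

text \<open>Young's inequality with parameter \<open>e\<close> takes the place of Cauchy-Schwarz;
  \<open>e\<close> then decreases to the norm.\<close>

lemma E_abs_le_Lp_norm_2:
  assumes X: "X \<in> H" shows "E (\<lambda>w. \<bar>X w\<bar>) \<le> Lp_norm E 2 X"
proof (rule dense_ge)
  fix e assume e: "Lp_norm E 2 X < e"
  then have e0: "e > 0" using Lp_norm_nonneg[of 2 X] by linarith
  have "\<bar>X w\<bar> \<le> (1 / (2 * e)) * (X w)\<^sup>2 + e / 2" for w
    using zero_le_power2[of "\<bar>X w\<bar> - e"] e0 by (simp add: field_simps power2_diff) (simp add: power2_eq_square)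
  then have "E (\<lambda>w. \<bar>X w\<bar>) \<le> E (\<lambda>w. (1 / (2 * e)) * (X w)\<^sup>2 + e / 2)"
    by (intro mono abs_mem X add_mem scale_mem square_mem const_mem)
  also have "\<dots> \<le> (1 / (2 * e)) * E (\<lambda>w. (X w)\<^sup>2) + e / 2"
  proof -
    have "E (\<lambda>w. (1 / (2 * e)) * (X w)\<^sup>2) = (1 / (2 * e)) * E (\<lambda>w. (X w)\<^sup>2)"
      by (rule pos_hom[OF square_mem[OF X]]) (use e0 in simp)
    with subadd[OF scale_mem[OF square_mem[OF X]] const_mem, of "1 / (2 * e)" "e / 2"]
    show ?thesis unfolding const by (simp only:)
  qed
  also have "\<dots> \<le> (1 / (2 * e)) * e\<^sup>2 + e / 2"
    using e e0 by (intro add_right_mono mult_left_mono) (simp_all add: Lp_norm_2_less_iff X)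
  also have "\<dots> = e" using e0 by (simp add: field_simps power2_eq_square)
  finally show "E (\<lambda>w. \<bar>X w\<bar>) \<le> e" .
qed

section \<open>Equivalence classes of Cauchy sequences\<close>

abbreviation "Cauchy2 \<equiv> Lp_Cauchy H E 2"
abbreviation "rel2 \<equiv> Lp_rel H E 2"
abbreviation "cls X \<equiv> rel2 `` {X}"

lemma Cauchy2_mem: "X \<in> Cauchy2 \<Longrightarrow> X n \<in> H"
  by (simp add: Lp_Cauchy_def)

lemma rel2_iff:
  "(X, Y) \<in> rel2 \<longleftrightarrow> X \<in> Cauchy2 \<and> Y \<in> Cauchy2 \<and>
    (\<forall>e>0. \<exists>N. \<forall>n\<ge>N. Lp_norm E 2 (\<lambda>w. X n w - Y n w) < e)"
  unfolding Lp_rel_def by (simp add: LIMSEQ_iff Lp_norm_nonneg)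

lemma Cauchy2I:
  assumes "\<And>n. X n \<in> H" "\<And>e. e > 0 \<Longrightarrow> \<exists>N. \<forall>m\<ge>N. \<forall>n\<ge>N. Lp_norm E 2 (\<lambda>w. X m w - X n w) < e"
  shows "X \<in> Cauchy2"
  using assms by (simp add: Lp_Cauchy_def)

lemma Cauchy2D:
  assumes "X \<in> Cauchy2" "e > 0"
  obtains N where "\<And>m n. m \<ge> N \<Longrightarrow> n \<ge> N \<Longrightarrow> Lp_norm E 2 (\<lambda>w. X m w - X n w) < e"
  using assms unfolding Lp_Cauchy_def by blast

lemma rel2D:
  assumes "(X, Y) \<in> rel2" "e > 0"
  obtains N where "\<And>n. n \<ge> N \<Longrightarrow> Lp_norm E 2 (\<lambda>w. X n w - Y n w) < e"
  using assms unfolding rel2_iff by blast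

lemma equiv_rel2: "equiv Cauchy2 rel2"
proof (rule equivI)
  show "rel2 \<subseteq> Cauchy2 \<times> Cauchy2" by (auto simp: Lp_rel_def)
  show "refl_on Cauchy2 rel2"
  proof (rule refl_onI)
    fix X assume "X \<in> Cauchy2"
    then show "(X, X) \<in> rel2" using Lp_norm_2[OF const_mem[of 0]] const[of 0] by (simp add: rel2_iff)
  qed
  show "sym rel2"
  proof (rule symI)
    fix X Y assume "(X, Y) \<in> rel2"
    then show "(Y, X) \<in> rel2" by (simp add: rel2_iff Lp_norm_def abs_minus_commute)
  qed
  show "trans rel2"
  proof (rule transI)
    fix X Y Z assume XY: "(X, Y) \<in> rel2" and YZ: "(Y, Z) \<in> rel2"
    then have c: "X \<in> Cauchy2" "Y \<in> Cauchy2" "Z \<in> Cauchy2" by (auto simp: rel2_iff)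
    have "\<exists>N. \<forall>n\<ge>N. Lp_norm E 2 (\<lambda>w. X n w - Z n w) < e" if e: "e > 0" for e
    proof -
      obtain N where N: "\<And>n. n \<ge> N \<Longrightarrow> Lp_norm E 2 (\<lambda>w. X n w - Y n w) < e / 2"
        using rel2D[OF XY half_gt_zero[OF e]] by blast
      obtain M where M: "\<And>n. n \<ge> M \<Longrightarrow> Lp_norm E 2 (\<lambda>w. Y n w - Z n w) < e / 2"
        using rel2D[OF YZ half_gt_zero[OF e]] by blast
      have "Lp_norm E 2 (\<lambda>w. X n w - Z n w) < e" if "n \<ge> max M N" for n
        by (rule Lp_norm_2_less_I[OF _ _ _ N M]) (use that in \<open>auto intro: diff_mem Cauchy2_mem c\<close>)
      then show ?thesis by blast
    qed
    with c show "(X, Z) \<in> rel2" by (simp add: rel2_iff)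
  qed
qed

text \<open>A contraction preserves Cauchy sequences and equivalence, so all sets in the union
  defining \<open>Lp_lift\<close> are the same class. It is applied to the negative part and to the
  shift.\<close>

lemma Lp_lift_cls:
  assumes X: "X \<in> Cauchy2" and mem: "\<And>Y. Y \<in> H \<Longrightarrow> f Y \<in> H"
    and contr: "\<And>Y Z. Y \<in> H \<Longrightarrow> Z \<in> H \<Longrightarrow>
      Lp_norm E 2 (\<lambda>w. f Y w - f Z w) \<le> Lp_norm E 2 (\<lambda>w. Y w - Z w)"
  shows "(\<lambda>n. f (X n)) \<in> Cauchy2" and "Lp_lift H E 2 f (cls X) = cls (\<lambda>n. f (X n))"
proof -
  have C: "(\<lambda>n. f (Y n)) \<in> Cauchy2" if "Y \<in> Cauchy2" for Y
    using that mem unfolding Lp_Cauchy_def by (fastforce intro: le_less_trans[OF contr])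
  from this[OF X] show "(\<lambda>n. f (X n)) \<in> Cauchy2" .
  have "(\<lambda>n. f (X n), \<lambda>n. f (Y n)) \<in> rel2" if "(X, Y) \<in> rel2" for Y
  proof -
    from that have Y: "Y \<in> Cauchy2" by (simp add: rel2_iff)
    show ?thesis unfolding rel2_iff
    proof (intro conjI C X Y allI impI)
      fix e :: real assume "e > 0"
      with that obtain N where "\<forall>n\<ge>N. Lp_norm E 2 (\<lambda>w. X n w - Y n w) < e" unfolding rel2_iff by blast
      then have "\<forall>n\<ge>N. Lp_norm E 2 (\<lambda>w. f (X n) w - f (Y n) w) < e"
        using contr[OF Cauchy2_mem[OF X] Cauchy2_mem[OF Y]] by (meson le_less_trans)
      then show "\<exists>N. \<forall>n\<ge>N. Lp_norm E 2 (\<lambda>w. f (X n) w - f (Y n) w) < e" by blast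
    qed
  qed
  then have "cls (\<lambda>n. f (Y n)) = cls (\<lambda>n. f (X n))" if "Y \<in> cls X" for Y
    using that equiv_class_eq[OF equiv_rel2] by blast
  moreover have "X \<in> cls X" by (rule equiv_class_self[OF equiv_rel2 X])
  ultimately show "Lp_lift H E 2 f (cls X) = cls (\<lambda>n. f (X n))"
    unfolding Lp_lift_def by blast
qed

lemma Lp_lift2_diff_cls:
  assumes X: "X \<in> Cauchy2" and Y: "Y \<in> Cauchy2"
  shows "(\<lambda>n w. X n w - Y n w) \<in> Cauchy2"
    and "Lp_lift2 H E 2 (\<lambda>X Y w. X w - Y w) (cls X) (cls Y) = cls (\<lambda>n w. X n w - Y n w)"
proof -
  have small: "Lp_norm E 2 (\<lambda>w. (A w - B w) - (A' w - B' w)) < e"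
    if "A \<in> H" "B \<in> H" "A' \<in> H" "B' \<in> H" "Lp_norm E 2 (\<lambda>w. A w - A' w) < e / 2" "Lp_norm E 2 (\<lambda>w. B w - B' w) < e / 2"
    for A B A' B' e
    by (rule Lp_norm_2_less_I[OF _ _ _ that(5,6)]) (use that in \<open>auto intro: diff_mem\<close>)
  have C: "(\<lambda>n w. X n w - Y n w) \<in> Cauchy2" if X: "X \<in> Cauchy2" and Y: "Y \<in> Cauchy2" for X Y
  proof (rule Cauchy2I)
    show "(\<lambda>w. X n w - Y n w) \<in> H" for n by (intro diff_mem Cauchy2_mem that)
    fix e :: real assume e: "e > 0"
    obtain N where N: "\<And>m n. m \<ge> N \<Longrightarrow> n \<ge> N \<Longrightarrow> Lp_norm E 2 (\<lambda>w. X m w - X n w) < e / 2"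
      using Cauchy2D[OF X half_gt_zero[OF e]] by blast
    obtain M where M: "\<And>m n. m \<ge> M \<Longrightarrow> n \<ge> M \<Longrightarrow> Lp_norm E 2 (\<lambda>w. Y m w - Y n w) < e / 2"
      using Cauchy2D[OF Y half_gt_zero[OF e]] by blast
    show "\<exists>N. \<forall>m\<ge>N. \<forall>n\<ge>N. Lp_norm E 2 (\<lambda>w. (X m w - Y m w) - (X n w - Y n w)) < e"
      by (intro exI[of _ "max M N"] allI impI small Cauchy2_mem[OF X] Cauchy2_mem[OF Y] N M) auto
  qed
  from this[OF X Y] show "(\<lambda>n w. X n w - Y n w) \<in> Cauchy2" .
  have "(\<lambda>n w. X n w - Y n w, \<lambda>n w. X' n w - Y' n w) \<in> rel2" if XX: "(X, X') \<in> rel2" and YY: "(Y, Y') \<in> rel2" for X' Y'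
  proof -
    from that have c: "X' \<in> Cauchy2" "Y' \<in> Cauchy2" by (auto simp: rel2_iff)
    show ?thesis unfolding rel2_iff
    proof (intro conjI C X Y c allI impI)
      fix e :: real assume e: "e > 0"
      obtain N where N: "\<And>n. n \<ge> N \<Longrightarrow> Lp_norm E 2 (\<lambda>w. X n w - X' n w) < e / 2"
        using rel2D[OF XX half_gt_zero[OF e]] by blast
      obtain M where M: "\<And>n. n \<ge> M \<Longrightarrow> Lp_norm E 2 (\<lambda>w. Y n w - Y' n w) < e / 2"
        using rel2D[OF YY half_gt_zero[OF e]] by blast
      show "\<exists>N. \<forall>n\<ge>N. Lp_norm E 2 (\<lambda>w. (X n w - Y n w) - (X' n w - Y' n w)) < e"
        by (intro exI[of _ "max M N"] allI impI small Cauchy2_mem[OF X] Cauchy2_mem[OF Y] Cauchy2_mem[OF c(1)] Cauchy2_mem[OF c(2)] N M) auto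
    qed
  qed
  then have "cls (\<lambda>n w. X' n w - Y' n w) = cls (\<lambda>n w. X n w - Y n w)" if "X' \<in> cls X" "Y' \<in> cls Y" for X' Y'
    using that equiv_class_eq[OF equiv_rel2] by blast
  moreover have "X \<in> cls X" "Y \<in> cls Y" by (rule equiv_class_self[OF equiv_rel2 X] equiv_class_self[OF equiv_rel2 Y])+
  ultimately show "Lp_lift2 H E 2 (\<lambda>X Y w. X w - Y w) (cls X) (cls Y) = cls (\<lambda>n w. X n w - Y n w)"
    unfolding Lp_lift2_def by blast
qed

abbreviation "L2 \<equiv> Lp_space H E 2"

text \<open>Expectations differ by at most the L2 distance, so they converge to a limit common to
  all representatives, which the definite description picks out.\<close>

lemma expect_cls:
  assumes X: "X \<in> Cauchy2"
  shows "(\<lambda>n. E (X n)) \<longlonglongrightarrow> expect L2 (cls X)"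
proof -
  have le: "\<bar>E A - E B\<bar> \<le> Lp_norm E 2 (\<lambda>w. A w - B w)" if "A \<in> H" "B \<in> H" for A B
    using abs_E_diff_le[OF that] E_abs_le_Lp_norm_2[OF diff_mem[OF that]] by linarith
  have "Cauchy (\<lambda>n. E (X n))"
  proof (rule CauchyI)
    fix e :: real assume "e > 0"
    with X obtain N where N: "\<And>m n. m \<ge> N \<Longrightarrow> n \<ge> N \<Longrightarrow> Lp_norm E 2 (\<lambda>w. X m w - X n w) < e"
      unfolding Lp_Cauchy_def by blast
    have "norm (E (X m) - E (X n)) < e" if "m \<ge> N" "n \<ge> N" for m n
      using le[OF Cauchy2_mem[OF X] Cauchy2_mem[OF X], of m n] N[OF that] by simp
    then show "\<exists>N. \<forall>m\<ge>N. \<forall>n\<ge>N. norm (E (X m) - E (X n)) < e" by blast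
  qed
  then obtain v where v: "(\<lambda>n. E (X n)) \<longlonglongrightarrow> v" using Cauchy_convergent convergent_def by blast
  have "(\<lambda>n. E (Y n)) \<longlonglongrightarrow> v" if "Y \<in> cls X" for Y
  proof -
    from that have Y: "Y \<in> Cauchy2" and XY: "(\<lambda>n. Lp_norm E 2 (\<lambda>w. X n w - Y n w)) \<longlonglongrightarrow> 0"
      by (auto simp: Lp_rel_def)
    have "(\<lambda>n. E (X n) - E (Y n)) \<longlonglongrightarrow> 0"
      by (rule Lim_null_comparison[OF _ XY]) (use le[OF Cauchy2_mem[OF X] Cauchy2_mem[OF Y]] in simp)
    from tendsto_diff[OF v this] show ?thesis by simp
  qed
  moreover have self: "X \<in> cls X" by (rule equiv_class_self[OF equiv_rel2 X])
  ultimately have "expect L2 (cls X) = v"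
    unfolding Lp_space_def expectation_space.simps using v
    by (intro the_equality) (auto intro: LIMSEQ_unique)
  with v show ?thesis by simp
qed

lemma neg_part_cls:
  assumes X: "X \<in> Cauchy2"
  shows "(\<lambda>n w. max (- X n w) 0) \<in> Cauchy2" and "neg_part L2 (cls X) = cls (\<lambda>n w. max (- X n w) 0)"
proof -
  have "Lp_norm E 2 (\<lambda>w. max (- Y w) 0 - max (- Z w) 0) \<le> Lp_norm E 2 (\<lambda>w. Y w - Z w)"
    if "Y \<in> H" "Z \<in> H" for Y Z
    by (intro Lp_norm_2_le diff_mem neg_part_mem that) auto
  note lift = Lp_lift_cls[where f = "\<lambda>X w. max (- X w) 0", OF X neg_part_mem this]
  show "(\<lambda>n w. max (- X n w) 0) \<in> Cauchy2" by (rule lift(1))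
  show "neg_part L2 (cls X) = cls (\<lambda>n w. max (- X n w) 0)"
    unfolding Lp_space_def expectation_space.select_convs by (rule lift(2))
qed

lemma qs_ge_cls:
  assumes "X \<in> Cauchy2" "Y \<in> Cauchy2"
  shows "qs_ge L2 (cls X) (cls Y) \<longleftrightarrow> (\<lambda>n. E (\<lambda>w. max (- (X n w - Y n w)) 0)) \<longlonglongrightarrow> 0"
proof -
  note D = Lp_lift2_diff_cls[OF assms]
  have "diff L2 (cls X) (cls Y) = cls (\<lambda>n w. X n w - Y n w)" using D(2) by (simp add: Lp_space_def)
  then show ?thesis
    using expect_cls[OF neg_part_cls(1)[OF D(1)]] unfolding qs_ge_def
    by (auto simp: neg_part_cls(2)[OF D(1)] intro: LIMSEQ_unique)
qed

text \<open>The absolute value is the sum of the negative parts of the difference and of its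
  negative; subadditivity gives one direction, monotonicity the other.\<close>

lemma qs_eq_cls:
  assumes X: "X \<in> Cauchy2" and Y: "Y \<in> Cauchy2"
  shows "qs_eq L2 (cls X) (cls Y) \<longleftrightarrow> (\<lambda>n. E (\<lambda>w. \<bar>X n w - Y n w\<bar>)) \<longlonglongrightarrow> 0"
proof -
  let ?P = "\<lambda>n w. max (- (X n w - Y n w)) 0" and ?Q = "\<lambda>n w. max (- (Y n w - X n w)) 0"
  have mem: "?P n \<in> H" "?Q n \<in> H" "(\<lambda>w. \<bar>X n w - Y n w\<bar>) \<in> H" for n
    by (intro neg_part_mem abs_mem diff_mem Cauchy2_mem X Y)+
  show ?thesis unfolding qs_eq_def qs_ge_cls[OF X Y] qs_ge_cls[OF Y X]
  proof (intro iffI conjI; (elim conjE)?)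
    assume P: "(\<lambda>n. E (?P n)) \<longlonglongrightarrow> 0" and Q: "(\<lambda>n. E (?Q n)) \<longlonglongrightarrow> 0"
    have "E (\<lambda>w. \<bar>X n w - Y n w\<bar>) \<le> E (?P n) + E (?Q n)" for n
    proof -
      have "(\<lambda>w. \<bar>X n w - Y n w\<bar>) = (\<lambda>w. ?P n w + ?Q n w)" by (auto simp: fun_eq_iff max_def)
      then show ?thesis using subadd[OF mem(1,2), of n n] by simp
    qed
    then have "\<forall>\<^sub>F n in sequentially. norm (E (\<lambda>w. \<bar>X n w - Y n w\<bar>)) \<le> E (?P n) + E (?Q n)"
      by (simp add: E_nonneg mem)
    from Lim_null_comparison[OF this] tendsto_add[OF P Q] show "(\<lambda>n. E (\<lambda>w. \<bar>X n w - Y n w\<bar>)) \<longlonglongrightarrow> 0" by simp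
  next
    assume A: "(\<lambda>n. E (\<lambda>w. \<bar>X n w - Y n w\<bar>)) \<longlonglongrightarrow> 0"
    have "norm (E (?P n)) \<le> E (\<lambda>w. \<bar>X n w - Y n w\<bar>)" "norm (E (?Q n)) \<le> E (\<lambda>w. \<bar>X n w - Y n w\<bar>)" for n
    proof -
      have "E (?P n) \<le> E (\<lambda>w. \<bar>X n w - Y n w\<bar>)" "E (?Q n) \<le> E (\<lambda>w. \<bar>X n w - Y n w\<bar>)"
        by (intro mono mem; simp)+
      then show "norm (E (?P n)) \<le> E (\<lambda>w. \<bar>X n w - Y n w\<bar>)" "norm (E (?Q n)) \<le> E (\<lambda>w. \<bar>X n w - Y n w\<bar>)"
        using E_nonneg[OF mem(1)[of n]] E_nonneg[OF mem(2)[of n]] by simp_all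
    qed
    then show "(\<lambda>n. E (?P n)) \<longlonglongrightarrow> 0" "(\<lambda>n. E (?Q n)) \<longlonglongrightarrow> 0"
      by (auto intro!: Lim_null_comparison[OF _ A])
  qed
qed

lemma const_seq_Cauchy2: "(\<lambda>_ _. c) \<in> Cauchy2"
  by (rule Cauchy2I) (use Lp_norm_2[OF const_mem[of 0]] const[of 0] const_mem in auto)

end

section \<open>Ergodicity\<close>

context G_normal_sequence
begin

text \<open>Squared differences are cylinder functions, so \<open>GE_shift\<close> makes the shift
  an isometry.\<close>

lemma U_G_cls:
  assumes X: "X \<in> G.Cauchy2"
  shows "(\<lambda>n. X n \<circ> shift s) \<in> G.Cauchy2" and "U_G 2 E \<xi> s (G.cls X) = G.cls (\<lambda>n. X n \<circ> shift s)"
proof -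
  have "Lp_norm GE 2 (\<lambda>\<omega>. (Y \<circ> shift s) \<omega> - (Z \<circ> shift s) \<omega>) = Lp_norm GE 2 (\<lambda>\<omega>. Y \<omega> - Z \<omega>)"
    if "Y \<in> Lip_Omega" "Z \<in> Lip_Omega" for Y Z
  proof -
    have sq: "(\<lambda>\<omega>. (Y \<omega> - Z \<omega>)\<^sup>2) \<in> Lip_Omega" by (intro G.square_mem G.diff_mem that)
    show ?thesis
      using GE_shift[OF sq, of s]
      by (simp add: G.Lp_norm_2 G.diff_mem that Lip_Omega_shift[unfolded o_def] o_def)
  qed
  then show "(\<lambda>n. X n \<circ> shift s) \<in> G.Cauchy2" and "U_G 2 E \<xi> s (G.cls X) = G.cls (\<lambda>n. X n \<circ> shift s)"
    using G.Lp_lift_cls[OF X, of "\<lambda>X. X \<circ> shift s"] by (auto simp: U_G_def Lip_Omega_shift)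
qed

lemma U_G_funpow_cls:
  assumes X: "X \<in> G.Cauchy2"
  shows "(U_G 2 E \<xi> \<tau> ^^ n) (G.cls X) = G.cls (\<lambda>k. X k \<circ> shift (real n * \<tau>))"
proof (induction n)
  case 0
  show ?case by (simp add: o_def shift_0)
next
  case (Suc n)
  have "U_G 2 E \<xi> \<tau> (G.cls (\<lambda>k. X k \<circ> shift (real n * \<tau>))) = G.cls (\<lambda>k. (X k \<circ> shift (real n * \<tau>)) \<circ> shift \<tau>)"
    by (rule U_G_cls(2)[OF U_G_cls(1)[OF X]])
  also have "(\<lambda>k. (X k \<circ> shift (real n * \<tau>)) \<circ> shift \<tau>) = (\<lambda>k. X k \<circ> shift (real (Suc n) * \<tau>))"
    by (simp add: fun_eq_iff shift_shift algebra_simps)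
  finally show ?case using Suc by simp
qed

text \<open>The order of choices matters: \<open>Y\<close> is fixed first, then \<open>n\<close>
  according to the time window of \<open>Y\<close>, and only then \<open>k\<close>, since the
  convergence in \<open>inv\<close> depends on \<open>n\<close>.\<close>

lemma invariant_near_constant:
  assumes X: "X \<in> G.Cauchy2" and tau: "\<tau> \<noteq> 0" and e: "e > 0"
    and inv: "\<And>n::nat. (\<lambda>k. GE (\<lambda>\<omega>. \<bar>X k (shift (real n * \<tau>) \<omega>) - X k \<omega>\<bar>)) \<longlonglongrightarrow> 0"
  shows "\<exists>c N. \<forall>k\<ge>N. GE (\<lambda>\<omega>. \<bar>X k \<omega> - c\<bar>) \<le> e"
proof -
  note mem = G.Cauchy2_mem[OF X]
  have tri: "GE (\<lambda>\<omega>. \<bar>Z \<omega>\<bar>) \<le> GE (\<lambda>\<omega>. \<bar>A \<omega>\<bar>) + GE (\<lambda>\<omega>. \<bar>B \<omega>\<bar>)"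
    if "A \<in> Lip_Omega" "B \<in> Lip_Omega" "Z \<in> Lip_Omega" "\<And>\<omega>. Z \<omega> = A \<omega> + B \<omega>" for A B Z :: "'d paths \<Rightarrow> real"
  proof -
    have "GE (\<lambda>\<omega>. \<bar>Z \<omega>\<bar>) \<le> GE (\<lambda>\<omega>. \<bar>A \<omega>\<bar> + \<bar>B \<omega>\<bar>)"
      by (intro G.mono G.add_mem G.abs_mem that(1-3)) (simp add: that(4))
    also have "\<dots> \<le> GE (\<lambda>\<omega>. \<bar>A \<omega>\<bar>) + GE (\<lambda>\<omega>. \<bar>B \<omega>\<bar>)"
      by (intro G.subadd G.abs_mem that(1,2))
    finally show ?thesis .
  qed
  \<comment> \<open>The final bound is \<open>d + 3 * d\<close>, which lies below
    \<open>e\<close>.\<close>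
  define d where "d = e / 6"
  have d: "d > 0" using e by (simp add: d_def)
  from X d obtain N where N: "\<And>m n. m \<ge> N \<Longrightarrow> n \<ge> N \<Longrightarrow> Lp_norm GE 2 (\<lambda>w. X m w - X n w) < d"
    unfolding Lp_Cauchy_def by blast
  have close: "GE (\<lambda>\<omega>. \<bar>X m \<omega> - X n \<omega>\<bar>) < d" if "m \<ge> N" "n \<ge> N" for m n
    using G.E_abs_le_Lp_norm_2[OF G.diff_mem[OF mem mem]] N[OF that] by (rule le_less_trans)
  define Y where "Y = X N"
  have Y: "Y \<in> Lip_Omega" by (simp add: Y_def mem)
  obtain S where S: "\<And>s b. s \<ge> S \<Longrightarrow> (\<And>c. b \<le> GE (\<lambda>\<omega>. \<bar>Y \<omega> - c\<bar>)) \<Longrightarrow> b \<le> GE (\<lambda>\<omega>. \<bar>Y \<omega> - Y (shift s \<omega>)\<bar>)"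
    using shift_deviation[OF Y] by blast
  obtain n :: nat where n: "S < real n * \<bar>\<tau>\<bar>" using reals_Archimedean3[of "\<bar>\<tau>\<bar>"] tau by auto
  define s where "s = real n * \<tau>"
  have sh: "(\<lambda>\<omega>. Z (shift s \<omega>)) \<in> Lip_Omega" if "Z \<in> Lip_Omega" for Z :: "'d paths \<Rightarrow> real" and s
    using Lip_Omega_shift[OF that] by (simp add: o_def)
  \<comment> \<open>The deviation bound concerns forward shifts. For negative \<open>s\<close>,
    shifting the whole difference by \<open>s\<close> turns one form into the other.\<close>
  have abs_s: "GE (\<lambda>\<omega>. \<bar>Y \<omega> - Y (shift \<bar>s\<bar> \<omega>)\<bar>) = GE (\<lambda>\<omega>. \<bar>Y (shift s \<omega>) - Y \<omega>\<bar>)"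
  proof (cases "s \<ge> 0")
    case True
    then show ?thesis by (simp add: abs_minus_commute)
  next
    case False
    have m: "(\<lambda>\<omega>. \<bar>Y \<omega> - Y (shift (-s) \<omega>)\<bar>) \<in> Lip_Omega"
      by (intro G.abs_mem G.diff_mem Y sh)
    from GE_shift[OF m, of s] False show ?thesis by (simp add: o_def shift_shift shift_0)
  qed
  from inv[of n] d obtain K where K: "\<And>k. k \<ge> K \<Longrightarrow> GE (\<lambda>\<omega>. \<bar>X k (shift s \<omega>) - X k \<omega>\<bar>) < d"
    unfolding LIMSEQ_iff s_def by fastforce
  define k where "k = max K N"
  note Ysh = sh[OF Y, of s] and Xsh = sh[OF mem, of k s]
  \<comment> \<open>Three errors below \<open>d\<close>: approximation of \<open>Y\<close> by
    \<open>X k\<close> at the shifted time, invariance of \<open>X\<close>, and approximation at the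
    original time.\<close>
  have "GE (\<lambda>\<omega>. \<bar>Y (shift s \<omega>) - Y \<omega>\<bar>) \<le> GE (\<lambda>\<omega>. \<bar>Y (shift s \<omega>) - X k (shift s \<omega>)\<bar>) + GE (\<lambda>\<omega>. \<bar>X k (shift s \<omega>) - Y \<omega>\<bar>)"
    by (rule tri[OF G.diff_mem[OF Ysh Xsh] G.diff_mem[OF Xsh Y] G.diff_mem[OF Ysh Y]]) simp
  also have "GE (\<lambda>\<omega>. \<bar>X k (shift s \<omega>) - Y \<omega>\<bar>) \<le> GE (\<lambda>\<omega>. \<bar>X k (shift s \<omega>) - X k \<omega>\<bar>) + GE (\<lambda>\<omega>. \<bar>X k \<omega> - Y \<omega>\<bar>)"
    by (rule tri[OF G.diff_mem[OF Xsh mem] G.diff_mem[OF mem Y] G.diff_mem[OF Xsh Y]]) simp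
  also have "GE (\<lambda>\<omega>. \<bar>Y (shift s \<omega>) - X k (shift s \<omega>)\<bar>) = GE (\<lambda>\<omega>. \<bar>Y \<omega> - X k \<omega>\<bar>)"
    using GE_shift[OF G.abs_mem[OF G.diff_mem[OF Y mem]]] by (simp add: o_def)
  finally have "GE (\<lambda>\<omega>. \<bar>Y (shift s \<omega>) - Y \<omega>\<bar>) < 3 * d"
    using close[of N k] close[of k N] K[of k] by (simp add: Y_def k_def)
  moreover have "\<bar>s\<bar> \<ge> S" using n by (simp add: s_def abs_mult)
  \<comment> \<open>Otherwise \<open>3 * d\<close> would bound all deviations from constants, hence
    also the shifted difference just estimated.\<close>
  ultimately have "\<exists>c. \<not> 3 * d \<le> GE (\<lambda>\<omega>. \<bar>Y \<omega> - c\<bar>)"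
    using S[of "\<bar>s\<bar>" "3 * d"] abs_s by force
  then obtain c where c: "GE (\<lambda>\<omega>. \<bar>Y \<omega> - c\<bar>) < 3 * d" unfolding not_le by blast
  have "GE (\<lambda>\<omega>. \<bar>X k \<omega> - c\<bar>) \<le> e" if "k \<ge> N" for k
  proof -
    have "GE (\<lambda>\<omega>. \<bar>X k \<omega> - c\<bar>) \<le> GE (\<lambda>\<omega>. \<bar>X k \<omega> - Y \<omega>\<bar>) + GE (\<lambda>\<omega>. \<bar>Y \<omega> - c\<bar>)"
      by (rule tri[OF G.diff_mem[OF mem Y] G.diff_mem[OF Y G.const_mem] G.diff_mem[OF mem G.const_mem]]) simp
    with close[OF that order_refl, folded Y_def] c d show ?thesis unfolding d_def by linarith
  qed
  then show ?thesis by blast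
qed

text \<open>The constants found for accuracies tending to 0 form a Cauchy sequence, being close to
  the same \<open>X k\<close>; their limit is the constant sought.\<close>

lemma invariant_constant:
  assumes X: "X \<in> G.Cauchy2" and tau: "\<tau> \<noteq> 0"
    and inv: "\<And>n::nat. (\<lambda>k. GE (\<lambda>\<omega>. \<bar>X k (shift (real n * \<tau>) \<omega>) - X k \<omega>\<bar>)) \<longlonglongrightarrow> 0"
  shows "\<exists>c. (\<lambda>k. GE (\<lambda>\<omega>. \<bar>X k \<omega> - c\<bar>)) \<longlonglongrightarrow> 0"
proof -
  note mem = G.Cauchy2_mem[OF X]
  define \<epsilon> where "\<epsilon> j = inverse (real (Suc j))" for j
  have "\<forall>j. \<exists>c N. \<forall>k\<ge>N. GE (\<lambda>\<omega>. \<bar>X k \<omega> - c\<bar>) \<le> \<epsilon> j"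
    using invariant_near_constant[OF X tau _ inv] by (simp add: \<epsilon>_def)
  then obtain c N where cN: "\<And>j k. k \<ge> N j \<Longrightarrow> GE (\<lambda>\<omega>. \<bar>X k \<omega> - c j\<bar>) \<le> \<epsilon> j" by metis
  have near: "GE (\<lambda>\<omega>. \<bar>X k \<omega> - b\<bar>) \<le> GE (\<lambda>\<omega>. \<bar>X k \<omega> - a\<bar>) + \<bar>a - b\<bar>" for k a b
  proof -
    have "GE (\<lambda>\<omega>. \<bar>X k \<omega> - b\<bar>) \<le> GE (\<lambda>\<omega>. \<bar>X k \<omega> - a\<bar> + \<bar>a - b\<bar>)"
      by (intro G.mono G.add_mem G.abs_mem G.diff_mem mem G.const_mem) auto
    also have "\<dots> \<le> GE (\<lambda>\<omega>. \<bar>X k \<omega> - a\<bar>) + GE (\<lambda>\<omega>. \<bar>a - b\<bar>)"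
      by (intro G.subadd G.abs_mem G.diff_mem mem G.const_mem)
    finally show ?thesis by (simp add: G.const)
  qed
  \<comment> \<open>Any \<open>k\<close> beyond both thresholds links the two constants.\<close>
  have cc: "\<bar>c i - c j\<bar> \<le> \<epsilon> i + \<epsilon> j" for i j
  proof -
    define k where "k = max (N i) (N j)"
    have "\<bar>c i - c j\<bar> = GE (\<lambda>\<omega>. \<bar>c i - c j\<bar>)" by (simp add: G.const)
    also have "\<dots> \<le> GE (\<lambda>\<omega>. \<bar>X k \<omega> - c i\<bar> + \<bar>X k \<omega> - c j\<bar>)"
      by (intro G.mono G.add_mem G.abs_mem G.diff_mem mem G.const_mem) auto
    also have "\<dots> \<le> GE (\<lambda>\<omega>. \<bar>X k \<omega> - c i\<bar>) + GE (\<lambda>\<omega>. \<bar>X k \<omega> - c j\<bar>)"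
      by (intro G.subadd G.abs_mem G.diff_mem mem G.const_mem)
    also have "\<dots> \<le> \<epsilon> i + \<epsilon> j" by (intro add_mono cN) (auto simp: k_def)
    finally show ?thesis .
  qed
  have eps: "\<epsilon> \<longlonglongrightarrow> 0" unfolding \<epsilon>_def by (rule LIMSEQ_inverse_real_of_nat)
  have "Cauchy c"
  proof (rule CauchyI)
    fix e :: real assume "e > 0"
    then obtain M where M: "\<And>j. j \<ge> M \<Longrightarrow> \<epsilon> j < e / 2"
      using eps half_gt_zero[of e] unfolding LIMSEQ_iff by (fastforce simp: abs_less_iff)
    have "norm (c i - c j) < e" if "i \<ge> M" "j \<ge> M" for i j
      using cc[of i j] M[OF that(1)] M[OF that(2)] by simp
    then show "\<exists>M. \<forall>i\<ge>M. \<forall>j\<ge>M. norm (c i - c j) < e" by blast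
  qed
  then obtain v where v: "c \<longlonglongrightarrow> v" using Cauchy_convergent convergent_def by blast
  have "(\<lambda>k. GE (\<lambda>\<omega>. \<bar>X k \<omega> - v\<bar>)) \<longlonglongrightarrow> 0"
  proof (rule LIMSEQ_I)
    fix e :: real assume e: "e > 0"
    have "(\<lambda>j. \<epsilon> j + \<bar>c j - v\<bar>) \<longlonglongrightarrow> 0 + \<bar>v - v\<bar>"
      by (intro tendsto_intros eps v)
    then have "\<forall>\<^sub>F j in sequentially. \<epsilon> j + \<bar>c j - v\<bar> < e" using e by (intro order_tendstoD(2)) auto
    then obtain j where j: "\<epsilon> j + \<bar>c j - v\<bar> < e" by (auto simp: eventually_sequentially)
    have "norm (GE (\<lambda>\<omega>. \<bar>X k \<omega> - v\<bar>) - 0) < e" if "k \<ge> N j" for k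
    proof -
      have "0 \<le> GE (\<lambda>\<omega>. \<bar>X k \<omega> - v\<bar>)" by (intro G.E_nonneg G.abs_mem G.diff_mem mem G.const_mem) auto
      with near[of k v "c j"] cN[OF that] j show ?thesis by simp
    qed
    then show "\<exists>M. \<forall>k\<ge>M. norm (GE (\<lambda>\<omega>. \<bar>X k \<omega> - v\<bar>) - 0) < e" by blast
  qed
  then show ?thesis by blast
qed

text \<open>Shared by the three systems: each contains the shifts by all natural multiples of one
  nonzero \<tau>, indexed by exponents or by times.\<close>

lemma ergodicI:
  assumes tau: "\<tau> \<noteq> 0"
    and U: "\<And>n. \<exists>t\<in>T. \<forall>X\<in>G.Cauchy2. U t (G.cls X) = G.cls (\<lambda>k. X k \<circ> shift (real n * \<tau>))"
  shows "ergodic (L_G 2 E \<xi>) T U"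
  unfolding ergodic_def L_G_def
proof (intro ballI impI)
  fix C assume "C \<in> elements G.L2" and inv: "\<forall>t\<in>T. qs_eq G.L2 (U t C) C"
  then obtain X where X: "X \<in> G.Cauchy2" and C: "C = G.cls X"
    by (auto simp: Lp_space_def elim: quotientE)
  have "(\<lambda>k. GE (\<lambda>\<omega>. \<bar>X k (shift (real n * \<tau>) \<omega>) - X k \<omega>\<bar>)) \<longlonglongrightarrow> 0" for n
  proof -
    from U obtain t where t: "t \<in> T" "U t C = G.cls (\<lambda>k. X k \<circ> shift (real n * \<tau>))" using X C by blast
    from inv t(1) have "qs_eq G.L2 (U t C) C" by blast
    then have "qs_eq G.L2 (G.cls (\<lambda>k. X k \<circ> shift (real n * \<tau>))) (G.cls X)" unfolding t(2) unfolding C .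
    then show ?thesis using G.qs_eq_cls[OF U_G_cls(1)[OF X] X] by simp
  qed
  then obtain c where "(\<lambda>k. GE (\<lambda>\<omega>. \<bar>X k \<omega> - c\<bar>)) \<longlonglongrightarrow> 0"
    using invariant_constant[OF X tau] by blast
  then have "qs_eq G.L2 (G.cls X) (G.cls (\<lambda>_ _. c))"
    by (simp add: G.qs_eq_cls X G.const_seq_Cauchy2)
  then show "\<exists>c. qs_eq G.L2 C (const_elem G.L2 c)"
    by (auto simp: C Lp_space_def)
qed

end

theorem theorem3p27:
  fixes H :: "('w \<Rightarrow> real) set"
    and E :: "('w \<Rightarrow> real) \<Rightarrow> real"
    and G :: "real ^ 'd ^ 'd \<Rightarrow> real"
    and \<xi> :: "nat \<Rightarrow> 'w \<Rightarrow> real ^ 'd"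
  assumes "sublinear_expectation H E"
    and "\<And>i. G_normal H E G (\<xi> i)"
    and "\<And>i j. eq_dist E (\<xi> i) (\<xi> j)"
    and "\<And>i. i \<ge> 1 \<Longrightarrow> indep_from E 1 (\<lambda>w _. \<xi> i w) i (\<lambda>w k. \<xi> k w)"
  shows "(\<forall>\<tau>. \<tau> \<noteq> 0 \<longrightarrow> ergodic (L_G 2 E \<xi>) (UNIV :: nat set) (\<lambda>n. U_G 2 E \<xi> \<tau> ^^ n))
    \<and> ergodic (L_G 2 E \<xi>) {0..} (U_G 2 E \<xi>)
    \<and> ergodic (L_G 2 E \<xi>) UNIV (U_G 2 E \<xi>)"
proof -
  interpret sublinear_expectation H E by (rule assms(1))
  interpret G_normal_sequence H E G \<xi> by unfold_locales (use assms in auto)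
  \<comment> \<open>In continuous time \<tau> is taken to be 1; the times \<open>real n\<close>
    belong to both index sets.\<close>
  have U: "\<forall>X\<in>G.Cauchy2. U_G 2 E \<xi> (real n) (G.cls X) = G.cls (\<lambda>k. X k \<circ> shift (real n * 1))" for n
    by (simp add: U_G_cls(2))
  have "ergodic (L_G 2 E \<xi>) {0..} (U_G 2 E \<xi>)"
    by (rule ergodicI[OF one_neq_zero]) (use U in \<open>auto intro!: bexI[of _ "real _"]\<close>)
  moreover have "ergodic (L_G 2 E \<xi>) UNIV (U_G 2 E \<xi>)"
    by (rule ergodicI[OF one_neq_zero]) (use U in blast)
  moreover have "ergodic (L_G 2 E \<xi>) (UNIV :: nat set) (\<lambda>n. U_G 2 E \<xi> \<tau> ^^ n)" if "\<tau> \<noteq> 0" for \<tau>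
    by (rule ergodicI[OF that]) (use U_G_funpow_cls in blast)
  ultimately show ?thesis by blast
qed

end
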